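(* Let $G$ be a finite graph on $n$ vertices and let $W(G)$ be its whiskered graph. The Gorenstein polytopes of the form $\operatorname{conv}(\mathcal{D}(W(G),\mathfrak{c}))$ with $\mathfrak{c}\in(\mathbb{Z}_{>0})^{2n}$ are exactly $\mathcal{Q}_{2n}$ and $\mathcal{Q}_{2n}'+(1,\ldots,1)$.
   Context: All graphs are finite with no loops, no multiple edges and no isolated vertices. For a graph $G$ on $\{x_1,\ldots,x_n\}$, the whiskered graph $W(G)$ is the graph on $\{x_1,\ldots,x_{2n}\}$ obtained from $G$ by adding the edges $\{x_i,x_{n+i}\}$ for $1\le i\le n$. Let $N\ge 3$ and let $\Gamma$ be a graph on $\{x_1,\ldots,x_N\}$. Let $S=K[x_1,\ldots,x_N]$ be the polynomial ring over a field $K$ and let $I(\Gamma)\subset S$ be the edge ideal, generated by the monomials $x_ix_j$ with $\{x_i,x_j\}\in E(\Gamma)$. For $\mathfrak{c}=(c_1,\ldots,c_N)\in(\mathbb{Z}_{>0})^N$ and an integer $q\ge1$, $(I(\Gamma)^q)_{\mathfrak{c}}$ is the ideal generated by the monomials $x_1^{a_1}\cdots x_N^{a_N}\in I(\Gamma)^q$ with $a_i\le c_i$ for all $i$. Let $\delta_{\mathfrak{c}}(I(\Gamma))$ be the largest $q$ with $(I(\Gamma)^q)_{\mathfrak{c}}\ne(0)$, and let $\mathcal{B}(\Gamma,\mathfrak{c})$ be the minimal set of monomial generators of $(I(\Gamma)^{\delta_{\mathfrak{c}}(I(\Gamma))})_{\mathfrak{c}}$. Let $\mathcal{D}(\Gamma,\mathfrak{c})$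 be the set of vectors $(a_1,\ldots,a_N)\in\mathbb{Z}_{\ge0}^N$ such that $x_1^{a_1}\cdots x_N^{a_N}$ divides some $u\in\mathcal{B}(\Gamma,\mathfrak{c})$, and let $\operatorname{conv}(\mathcal{D}(\Gamma,\mathfrak{c}))\subset\mathbb{R}^N$ be its convex hull. A lattice polytope (all vertices in $\mathbb{Z}^N$) $\mathcal{P}\subset\mathbb{R}^N$ of dimension $N$ is reflexive if the origin lies in its interior and its dual $\mathcal{P}^\vee=\{x\in\mathbb{R}^N:\sum_i x_iy_i\le1\ \forall y\in\mathcal{P}\}$ is a lattice polytope. A lattice polytope $\mathcal{P}\subset\mathbb{R}^N$ of dimension $N$ is Gorenstein if there are an integer $\delta>0$ and $\mathbf{a}\in\mathbb{Z}^N$ such that $\delta\mathcal{P}-\mathbf{a}$ is reflexive. $\mathcal{Q}_N=[0,1]^N\subset\mathbb{R}^N$ is the standard unit cube and $\mathcal{Q}_N'=2\mathcal{Q}_N-(1,\ldots,1)=[-1,1]^N$, so $\mathcal{Q}_N'+(1,\ldots,1)=[0,2]^N$. *)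

theory Defs
  imports "HOL-Analysis.Analysis" "HOL-Library.Poly_Mapping"
begin

section \<open>Graphs and whiskering\<close>

text \<open>The vertex set is the whole (finite) type \<open>'v\<close>, so a graph is given by its edge set.\<close>

definition graph :: "'v::finite set set \<Rightarrow> bool" where
  "graph E \<longleftrightarrow> (\<forall>e\<in>E. card e = 2) \<and> (\<forall>v. \<exists>e\<in>E. v \<in> e)"

text \<open>\<open>Inl i\<close> plays the role of $x_i$ and \<open>Inr i\<close> that of $x_{n+i}$.\<close>

definition whisker :: "'v set set \<Rightarrow> ('v + 'v) set set" where
  "whisker E = (\<lambda>e. Inl ` e) ` E \<union> {{Inl i, Inr i} | i. True}"

section \<open>Polynomials and ideals\<close>

text \<open>Polynomials over \<open>'k\<close> in variables indexed by \<open>'v\<close>: finitely supported coefficient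
  functions on exponent vectors, with the convolution product of \<open>Poly_Mapping\<close>.\<close>

type_synonym ('v, 'k) mpoly = "('v \<Rightarrow>\<^sub>0 nat) \<Rightarrow>\<^sub>0 'k"

definition monomial :: "('v \<Rightarrow>\<^sub>0 nat) \<Rightarrow> ('v, 'k::field) mpoly" where
  "monomial a = Poly_Mapping.single a 1"

definition var :: "'v \<Rightarrow> ('v, 'k::field) mpoly" where
  "var v = monomial (Poly_Mapping.single v 1)"

lemma module_times: "module ((*) :: 'a::comm_ring_1 \<Rightarrow> 'a \<Rightarrow> 'a)"
  by unfold_locales (simp_all add: algebra_simps)

text \<open>Ideals are the submodules of the ring regarded as a module over itself.\<close>

definition ideal_gen :: "'a::comm_ring_1 set \<Rightarrow> 'a set" where
  "ideal_gen = module.span (*)"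

definition ideal_mult :: "'a::comm_ring_1 set \<Rightarrow> 'a set \<Rightarrow> 'a set" where
  "ideal_mult I J = ideal_gen {f * g | f g. f \<in> I \<and> g \<in> J}"

primrec ideal_power :: "'a::comm_ring_1 set \<Rightarrow> nat \<Rightarrow> 'a set" where
  "ideal_power I 0 = UNIV"
| "ideal_power I (Suc q) = ideal_mult I (ideal_power I q)"

definition edge_ideal :: "'v set set \<Rightarrow> ('v, 'k::field) mpoly set" where
  "edge_ideal E = ideal_gen {var u * var v | u v. {u, v} \<in> E}"

definition bounded_part ::
    "('v \<Rightarrow> nat) \<Rightarrow> ('v, 'k::field) mpoly set \<Rightarrow> ('v, 'k) mpoly set" where
  "bounded_part c I =
     ideal_gen {monomial a | a. monomial a \<in> I \<and> (\<forall>v. Poly_Mapping.lookup a v \<le> c v)}"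

definition delta :: "('v \<Rightarrow> nat) \<Rightarrow> ('v, 'k::field) mpoly set \<Rightarrow> nat" where
  "delta c I = (GREATEST q. 1 \<le> q \<and> bounded_part c (ideal_power I q) \<noteq> {0})"

definition minimal_monomial_generators ::
    "('v, 'k::field) mpoly set \<Rightarrow> ('v, 'k) mpoly set \<Rightarrow> bool" where
  "minimal_monomial_generators J B \<longleftrightarrow>
     B \<subseteq> range monomial \<and> ideal_gen B = J \<and> (\<forall>B'. B' \<subset> B \<longrightarrow> ideal_gen B' \<noteq> J)"

text \<open>A monomial ideal in finitely many variables has exactly one minimal set of monomial
  generators, which justifies the definite description below. The field \<open>'k\<close> does not occur in
  the type of \<open>divisor_vectors\<close>, hence its explicit type argument.\<close>

definition top_generators ::
    "'v set set \<Rightarrow> ('v \<Rightarrow> nat) \<Rightarrow> ('v, 'k::field) mpoly set" where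
  "top_generators E c =
     (let I = edge_ideal E
      in THE B. minimal_monomial_generators (bounded_part c (ideal_power I (delta c I))) B)"

definition divisor_vectors ::
    "'k::field itself \<Rightarrow> 'v::finite set set \<Rightarrow> ('v \<Rightarrow> nat) \<Rightarrow> (real ^ 'v) set" where
  "divisor_vectors K E c =
     {\<chi> v. real (Poly_Mapping.lookup a v) | a.
        \<exists>u \<in> (top_generators E c :: ('v, 'k) mpoly set). monomial a dvd u}"

section \<open>Lattice polytopes\<close>

definition lattice_points :: "(real ^ 'v) set" where
  "lattice_points = {x. \<forall>i. x $ i \<in> \<int>}"

definition lattice_polytope :: "(real ^ 'v::finite) set \<Rightarrow> bool" where
  "lattice_polytope P \<longleftrightarrow> polytope P \<and> {v. v extreme_point_of P} \<subseteq> lattice_points"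

definition dual :: "(real ^ 'v::finite) set \<Rightarrow> (real ^ 'v) set" where
  "dual P = {x. \<forall>y\<in>P. x \<bullet> y \<le> 1}"

definition reflexive_polytope :: "(real ^ 'v::finite) set \<Rightarrow> bool" where
  "reflexive_polytope P \<longleftrightarrow>
     lattice_polytope P \<and> aff_dim P = int CARD('v) \<and> 0 \<in> interior P \<and> lattice_polytope (dual P)"

definition gorenstein_polytope :: "(real ^ 'v::finite) set \<Rightarrow> bool" where
  "gorenstein_polytope P \<longleftrightarrow>
     lattice_polytope P \<and> aff_dim P = int CARD('v) \<and>
     (\<exists>d::nat. d > 0 \<and> (\<exists>a\<in>lattice_points. reflexive_polytope ((\<lambda>x. real d *\<^sub>R x - a) ` P)))"

definition unit_cube :: "(real ^ 'v::finite) set" where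
  "unit_cube = {x. \<forall>i. 0 \<le> x $ i \<and> x $ i \<le> 1}"

text \<open>The numeral \<open>1\<close> of type \<open>real ^ 'v\<close> is the vector $(1,\ldots,1)$.\<close>

definition centered_cube :: "(real ^ 'v::finite) set" where
  "centered_cube = (\<lambda>x. 2 *\<^sub>R x - 1) ` unit_cube"

end

theory Submission
  imports Defs
begin

text \<open>Call a multiset of edges whose degrees are bounded by \<open>c\<close> a b-matching. Every b-matching is
  dominated in degree by one of maximum size, so the divisor vectors are exactly the vectors below
  degree vectors of b-matchings of any size. In a reflexive polytope every facet has lattice
  distance one from the origin. The facets of the coordinate hyperplanes therefore force the
  translation vector to be the all-one vector, and the facets of the leaves force
  \<open>d * min (c x) (c y) = 2\<close> for every whisker \<open>{x, y}\<close> with leaf \<open>y\<close>, where \<open>d\<close> is the dilation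
  factor. If \<open>c x > c y\<close>, a facet on which \<open>x\<close> has its maximal degree violates the same condition.
  Hence \<open>c\<close> takes one value, 1 or 2, at all vertices of the original graph and is at least as large
  on the leaves, and the perfect matching of whiskers makes the polytope a cube.\<close>

section \<open>b-Matchings\<close>

definition mdeg :: "'v set multiset \<Rightarrow> 'v \<Rightarrow> nat" where
  "mdeg M v = size (filter_mset (\<lambda>e. v \<in> e) M)"

text \<open>Edges carry multiplicities because a product of generators of the edge ideal may repeat
  a factor; the size of the multiset is the exponent of the power of the ideal.\<close>

definition b_matching :: "'v set set \<Rightarrow> ('v \<Rightarrow> nat) \<Rightarrow> 'v set multiset \<Rightarrow> bool" where
  "b_matching E c M \<longleftrightarrow> set_mset M \<subseteq> E \<and> mdeg M \<le> c"

lemma mdeg_empty [simp]: "mdeg {#} v = 0"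
  by (simp add: mdeg_def)

lemma mdeg_add_mset: "mdeg (add_mset e M) v = (if v \<in> e then 1 else 0) + mdeg M v"
  by (simp add: mdeg_def)

lemma mdeg_union: "mdeg (M + N) v = mdeg M v + mdeg N v"
  by (simp add: mdeg_def)

lemma mdeg_replicate: "mdeg (replicate_mset k e) v = (if v \<in> e then k else 0)"
  by (induction k) (simp_all add: mdeg_add_mset)

lemma mdeg_sum: "mdeg (\<Sum>i\<in>I. f i) v = (\<Sum>i\<in>I. mdeg (f i) v)"
  by (induction I rule: infinite_finite_induct) (simp_all add: mdeg_union)

lemma mdeg_diff_single: "e \<in># M \<Longrightarrow> mdeg (M - {#e#}) v = mdeg M v - (if v \<in> e then 1 else 0)"
  by (metis add_diff_cancel_left' insert_DiffM mdeg_add_mset)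

lemma sum_mdeg:
  fixes M :: "'v::finite set multiset"
  assumes "\<forall>e\<in>#M. card e = 2"
  shows "(\<Sum>v\<in>UNIV. mdeg M v) = 2 * size M"
  using assms
  by (induction M) (simp_all add: mdeg_add_mset sum.distrib sum.If_cases)

text \<open>Summing the degrees counts every edge twice. The bound makes maximum b-matchings exist
  and \<open>delta\<close> a maximum over a bounded set.\<close>

lemma size_b_matching:
  fixes c :: "'v::finite \<Rightarrow> nat"
  assumes "\<forall>e\<in>E. card e = 2" "b_matching E c M"
  shows "2 * size M \<le> sum c UNIV"
proof -
  have "\<forall>e\<in>#M. card e = 2"
    using assms unfolding b_matching_def by blast
  then have "2 * size M = (\<Sum>v\<in>UNIV. mdeg M v)"
    by (simp add: sum_mdeg)
  also have "\<dots> \<le> sum c UNIV"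
    using assms(2) by (intro sum_mono) (simp add: b_matching_def le_fun_def)
  finally show ?thesis .
qed

lemma ex_count_less:
  assumes "size (filter_mset P N) < size (filter_mset P M)"
  shows "\<exists>e. P e \<and> count N e < count M e"
proof (rule ccontr)
  assume "\<not> ?thesis"
  then have "filter_mset P M \<subseteq># filter_mset P N"
    by (auto simp: subseteq_mset_def not_less)
  then show False
    using assms size_mset_mono by fastforce
qed

text \<open>An exchange argument: where \<open>M\<close> exceeds a maximum \<open>N\<close> at
  \<open>v\<close>, some edge of \<open>N\<close> can be traded for an edge of \<open>M\<close> at
  \<open>v\<close>. This is what lets the top power of the ideal see every b-matching.\<close>

lemma b_matching_dominated_by_maximum:
  fixes c :: "'v::finite \<Rightarrow> nat"
  assumes two: "\<forall>e\<in>E. card e = 2" and M: "b_matching E c M"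
  obtains N where "b_matching E c N" "\<And>L. b_matching E c L \<Longrightarrow> size L \<le> size N" "mdeg M \<le> mdeg N"
proof -
  define maxm where "maxm N \<longleftrightarrow> b_matching E c N \<and> (\<forall>L. b_matching E c L \<longrightarrow> size L \<le> size N)" for N
  have "\<forall>L. b_matching E c L \<longrightarrow> size L < Suc (sum c UNIV)"
    using size_b_matching[OF two] by fastforce
  then have ex: "\<exists>N. maxm N"
    unfolding maxm_def by (rule ex_has_greatest_nat[of "b_matching E c" M size, OF M])
  \<comment> \<open>Among the maximum b-matchings, take one sharing as many edges with \<open>M\<close> as possible.\<close>
  obtain N where N: "maxm N" and opt: "\<And>L. maxm L \<Longrightarrow> size (M \<inter># L) \<le> size (M \<inter># N)"
  proof -
    obtain N0 where "maxm N0"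
      using ex by blast
    moreover have "\<forall>L. maxm L \<longrightarrow> size (M \<inter># L) < Suc (size M)"
      by (simp add: size_mset_mono less_Suc_eq_le)
    ultimately have "\<exists>N. maxm N \<and> (\<forall>L. maxm L \<longrightarrow> size (M \<inter># L) \<le> size (M \<inter># N))"
      by (rule ex_has_greatest_nat)
    then show thesis
      using that by blast
  qed
  have "mdeg M v \<le> mdeg N v" for v
  proof (rule ccontr)
    assume less: "\<not> mdeg M v \<le> mdeg N v"
    then obtain e where e: "v \<in> e" "count N e < count M e"
      using ex_count_less[of "\<lambda>e. v \<in> e" N M] by (auto simp: mdeg_def)
    have eE: "e \<in> E"
      using e(2) M by (metis b_matching_def count_inI not_less_zero subsetD)
    then obtain w where w: "e = {v, w}" "v \<noteq> w"
      using two e(1) by (metis card_2_iff doubleton_eq_iff insertE singletonD)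
    have vc: "mdeg N v < c v"
      using less M by (metis b_matching_def le_fun_def not_le order_less_le_trans)
    have Nb: "set_mset N \<subseteq> E" "\<And>u. mdeg N u \<le> c u"
      using N by (auto simp: maxm_def b_matching_def le_fun_def)
    \<comment> \<open>Otherwise \<open>e\<close> could be added to \<open>N\<close>, which is
      maximum.\<close>
    have wc: "mdeg N w = c w"
    proof (rule ccontr)
      assume "mdeg N w \<noteq> c w"
      then have "mdeg N w < c w"
        using Nb(2)[of w] by simp
      then have "b_matching E c (add_mset e N)"
        using Nb vc eE by (auto simp: b_matching_def le_fun_def mdeg_add_mset w Suc_le_eq)
      then show False
        using N by (fastforce simp: maxm_def)
    qed
    \<comment> \<open>\<open>M\<close> has more copies of \<open>e\<close> at the saturated vertex
      \<open>w\<close> but no larger degree there, so some other edge at \<open>w\<close> is more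
      frequent in \<open>N\<close>.\<close>
    have "\<exists>f. w \<in> f \<and> count M f < count N f"
    proof (rule ccontr)
      assume no: "\<not> ?thesis"
      then have "filter_mset (\<lambda>f. w \<in> f) N \<subseteq># filter_mset (\<lambda>f. w \<in> f) M"
        by (auto simp: subseteq_mset_def not_less)
      moreover have "filter_mset (\<lambda>f. w \<in> f) N \<noteq> filter_mset (\<lambda>f. w \<in> f) M"
        using e(2) w by (metis count_filter_mset insertI1 insert_commute less_irrefl)
      ultimately have "mdeg N w < mdeg M w"
        unfolding mdeg_def by (intro mset_subset_size) (simp add: subset_mset_def)
      then show False
        using wc M by (metis b_matching_def le_fun_def not_le)
    qed
    then obtain f where f: "w \<in> f" "count M f < count N f"
      by blast
    have ef: "e \<noteq> f" and fN: "f \<in># N"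
      using e f by (auto simp flip: count_greater_zero_iff)
    \<comment> \<open>Two edges through both \<open>v\<close> and \<open>w\<close> would coincide.
      So removing \<open>f\<close> frees a unit at \<open>w\<close>, and \<open>v\<close> has room
      of its own.\<close>
    have vf: "v \<notin> f"
    proof
      assume "v \<in> f"
      moreover have "card f = 2"
        using fN Nb(1) two by blast
      ultimately show False
        using f(1) w ef by (auto simp: card_2_iff)
    qed
    define N' where "N' = add_mset e (N - {#f#})"
    have "b_matching E c N'"
      unfolding b_matching_def
    proof
      show "set_mset N' \<subseteq> E"
        using Nb(1) eE by (auto simp: N'_def dest: in_diffD)
      show "mdeg N' \<le> c"
      proof (rule le_funI)
        fix u
        have "mdeg N' u = (if u \<in> e then 1 else 0) + (mdeg N u - (if u \<in> f then 1 else 0))"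
          by (simp add: N'_def mdeg_add_mset mdeg_diff_single fN)
        moreover have "mdeg N w > 0"
          using f(1) multi_member_split[OF fN] by (auto simp: mdeg_add_mset)
        ultimately show "mdeg N' u \<le> c u"
          using Nb(2)[of u] vc w vf f(1) by (auto split: if_splits)
      qed
    qed
    moreover have "size N' = size N"
      using multi_member_split[OF fN] by (auto simp: N'_def)
    ultimately have "maxm N'"
      using N by (simp add: maxm_def)
    \<comment> \<open>\<open>N\<close> has more copies of \<open>f\<close> than \<open>M\<close>, so
      dropping one costs the intersection nothing, while the new copy of \<open>e\<close> enlarges
      it.\<close>
    moreover have "M \<inter># N \<subset># M \<inter># N'"
    proof (rule subset_mset.le_neq_trans)
      show "M \<inter># N \<subseteq># M \<inter># N'"
        using ef f(2) by (auto simp: subseteq_mset_def N'_def)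
      have "count (M \<inter># N) e < count (M \<inter># N') e"
        using e(2) ef by (simp add: N'_def)
      then show "M \<inter># N \<noteq> M \<inter># N'"
        by (metis less_irrefl)
    qed
    ultimately show False
      using opt mset_subset_size by (metis not_le)
  qed
  then show thesis
    using N that unfolding maxm_def le_fun_def by blast
qed

section \<open>Monomial ideals\<close>

interpretation ring_module: module "(*) :: 'a::comm_ring_1 \<Rightarrow> 'a \<Rightarrow> 'a"
  by (rule module_times)

lemma ideal_gen_subsetI: "S \<subseteq> ideal_gen T \<Longrightarrow> ideal_gen S \<subseteq> ideal_gen T"
  by (simp add: ideal_gen_def ring_module.span_minimal)

lemma keys_monomial [simp]: "Poly_Mapping.keys (monomial a :: ('v, 'k::field) mpoly) = {a}"
  by (simp add: monomial_def)

lemma monomial_mult: "monomial a * monomial b = monomial (a + b)"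
  by (simp add: monomial_def mult_single)

lemma lookup_le_iff_add:
  fixes s t :: "'v \<Rightarrow>\<^sub>0 nat"
  shows "Poly_Mapping.lookup s \<le> Poly_Mapping.lookup t \<longleftrightarrow> (\<exists>r. t = s + r)"
proof
  assume "Poly_Mapping.lookup s \<le> Poly_Mapping.lookup t"
  then have "t = s + (t - s)"
    by (intro poly_mapping_eqI) (simp add: lookup_add lookup_minus le_fun_def)
  then show "\<exists>r. t = s + r" ..
qed (auto simp: le_fun_def lookup_add)

text \<open>Every exponent of a product is a sum of exponents of the factors, so the right-hand side
  is an ideal; conversely a polynomial is the sum of its terms, each a multiple of a generator.
  Membership becomes a comparison of exponents.\<close>

lemma monomial_ideal:
  "ideal_gen (monomial ` T :: ('v, 'k::field) mpoly set)
     = {f. \<forall>t\<in>Poly_Mapping.keys f. \<exists>s\<in>T. Poly_Mapping.lookup s \<le> Poly_Mapping.lookup t}" (is "_ = ?R")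
proof
  show "ideal_gen (monomial ` T) \<subseteq> ?R"
    unfolding ideal_gen_def
  proof (rule ring_module.span_minimal)
    show "ring_module.subspace ?R"
    proof (rule ring_module.subspaceI)
      fix f g :: "('v, 'k) mpoly"
      assume "f \<in> ?R" "g \<in> ?R"
      then show "f + g \<in> ?R"
        using Poly_Mapping.keys_add[of f g] by blast
    next
      fix f g :: "('v, 'k) mpoly"
      assume g: "g \<in> ?R"
      show "f * g \<in> ?R"
      proof (intro CollectI ballI)
        fix t
        assume "t \<in> Poly_Mapping.keys (f * g)"
        then obtain a b where t: "t = a + b" "b \<in> Poly_Mapping.keys g"
          using Poly_Mapping.keys_mult[of f g] by blast
        then obtain s where "s \<in> T" "Poly_Mapping.lookup s \<le> Poly_Mapping.lookup b"
          using g by blast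
        then show "\<exists>s\<in>T. Poly_Mapping.lookup s \<le> Poly_Mapping.lookup t"
          by (intro bexI[of _ s]) (auto simp: t lookup_add le_fun_def intro: trans_le_add2)
      qed
    qed simp
  qed auto
  show "?R \<subseteq> ideal_gen (monomial ` T)"
  proof
    fix f :: "('v, 'k) mpoly"
    assume f: "f \<in> ?R"
    have "Poly_Mapping.single t (Poly_Mapping.lookup f t) \<in> ideal_gen (monomial ` T)" if t: "t \<in> Poly_Mapping.keys f" for t
    proof -
      obtain s r where "s \<in> T" "t = s + r"
        using f t by (auto simp: lookup_le_iff_add)
      moreover have "Poly_Mapping.single t (Poly_Mapping.lookup f t) = Poly_Mapping.single r (Poly_Mapping.lookup f t) * monomial s"
        by (simp add: monomial_def mult_single \<open>t = s + r\<close> add.commute)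
      ultimately show ?thesis
        unfolding ideal_gen_def by (simp add: ring_module.span_base ring_module.span_scale)
    qed
    then have "(\<Sum>t\<in>Poly_Mapping.keys f. Poly_Mapping.single t (Poly_Mapping.lookup f t)) \<in> ideal_gen (monomial ` T)"
      unfolding ideal_gen_def by (rule ring_module.span_sum)
    moreover have "f = (\<Sum>t\<in>Poly_Mapping.keys f. Poly_Mapping.single t (Poly_Mapping.lookup f t))"
      by (rule poly_mapping_eqI) (simp add: lookup_sum lookup_single when_def in_keys_iff)
    ultimately show "f \<in> ideal_gen (monomial ` T)"
      by simp
  qed
qed

lemma monomial_in_monomial_ideal:
  "(monomial t :: ('v, 'k::field) mpoly) \<in> ideal_gen (monomial ` T) \<longleftrightarrow> (\<exists>s\<in>T. Poly_Mapping.lookup s \<le> Poly_Mapping.lookup t)"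
  by (simp add: monomial_ideal)

text \<open>Divisibility by a monomial is membership in the principal ideal that it
  generates.\<close>

lemma monomial_dvd_monomial:
  "(monomial a :: ('v, 'k::field) mpoly) dvd monomial b \<longleftrightarrow> Poly_Mapping.lookup a \<le> Poly_Mapping.lookup b"
proof
  assume "(monomial a :: ('v, 'k) mpoly) dvd monomial b"
  then obtain g :: "('v, 'k) mpoly" where "monomial b = monomial a * g"
    by (auto simp: dvd_def)
  then have "monomial b = g * (monomial a :: ('v, 'k) mpoly)"
    by (simp add: mult.commute)
  then have "(monomial b :: ('v, 'k) mpoly) \<in> ideal_gen (monomial ` {a})"
    unfolding ideal_gen_def by (metis image_insert ring_module.span_scale ring_module.span_base image_eqI insertI1)
  then show "Poly_Mapping.lookup a \<le> Poly_Mapping.lookup b"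
    unfolding monomial_in_monomial_ideal by simp
next
  assume "Poly_Mapping.lookup a \<le> Poly_Mapping.lookup b"
  then show "(monomial a :: ('v, 'k) mpoly) dvd monomial b"
    by (metis dvd_triv_left lookup_le_iff_add monomial_mult)
qed

lemma ideal_mult_monomial:
  "ideal_mult (ideal_gen (monomial ` S)) (ideal_gen (monomial ` T))
     = ideal_gen (monomial ` {s + t | s t. s \<in> S \<and> t \<in> T} :: ('v, 'k::field) mpoly set)"
    (is "_ = ?R")
proof
  show "ideal_mult (ideal_gen (monomial ` S)) (ideal_gen (monomial ` T)) \<subseteq> ?R"
    unfolding ideal_mult_def
  proof (rule ideal_gen_subsetI)
    show "{f * g |f g. f \<in> ideal_gen (monomial ` S) \<and> g \<in> ideal_gen (monomial ` T)} \<subseteq> ?R"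
    proof clarify
      fix f g :: "('v, 'k) mpoly"
      assume f: "f \<in> ideal_gen (monomial ` S)" and g: "g \<in> ideal_gen (monomial ` T)"
      show "f * g \<in> ?R"
        unfolding monomial_ideal
      proof (intro CollectI ballI)
        fix r
        assume "r \<in> Poly_Mapping.keys (f * g)"
        then obtain a b where r: "r = a + b" "a \<in> Poly_Mapping.keys f" "b \<in> Poly_Mapping.keys g"
          using Poly_Mapping.keys_mult[of f g] by blast
        obtain s where s: "s \<in> S" "Poly_Mapping.lookup s \<le> Poly_Mapping.lookup a"
          using f r unfolding monomial_ideal by blast
        obtain t where t: "t \<in> T" "Poly_Mapping.lookup t \<le> Poly_Mapping.lookup b"
          using g r unfolding monomial_ideal by blast
        have "Poly_Mapping.lookup (s + t) \<le> Poly_Mapping.lookup r"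
          using s t by (auto simp: r lookup_add le_fun_def intro: add_mono)
        then show "\<exists>u\<in>{s + t |s t. s \<in> S \<and> t \<in> T}. Poly_Mapping.lookup u \<le> Poly_Mapping.lookup r"
          using s t by blast
      qed
    qed
  qed
  have "monomial ` {s + t | s t. s \<in> S \<and> t \<in> T} \<subseteq>
          {f * g |f g :: ('v, 'k) mpoly. f \<in> ideal_gen (monomial ` S) \<and> g \<in> ideal_gen (monomial ` T)}"
  proof clarify
    fix s t
    assume "s \<in> S" "t \<in> T"
    then show "\<exists>f g. (monomial (s + t) :: ('v, 'k) mpoly) = f * g
        \<and> f \<in> ideal_gen (monomial ` S) \<and> g \<in> ideal_gen (monomial ` T)"
      by (intro exI[of _ "monomial s"] exI[of _ "monomial t"])
        (simp add: monomial_mult ideal_gen_def ring_module.span_base)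
  qed
  then show "?R \<subseteq> ideal_mult (ideal_gen (monomial ` S)) (ideal_gen (monomial ` T))"
    unfolding ideal_mult_def by (subst (1 2) ideal_gen_def) (rule ring_module.span_mono)
qed

text \<open>This evaluates the definite description in \<open>top_generators\<close>. For any
  monomial generating set, \<open>t\<close> in \<open>T\<close> lies above one of its exponents
  \<open>s\<close>, and \<open>s\<close> above some \<open>r\<close> in \<open>T\<close>; the
  antichain condition gives \<open>r = s = t\<close>. So every monomial generating set contains the
  monomials of \<open>T\<close>.\<close>

lemma minimal_monomial_generators_antichain:
  assumes anti: "\<And>s t. s \<in> T \<Longrightarrow> t \<in> T \<Longrightarrow> Poly_Mapping.lookup s \<le> Poly_Mapping.lookup t \<Longrightarrow> s = t"
  shows "minimal_monomial_generators (ideal_gen (monomial ` T)) B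
           \<longleftrightarrow> B = (monomial ` T :: ('v, 'k::field) mpoly set)"
proof
  let ?m = "monomial :: _ \<Rightarrow> ('v, 'k) mpoly"
  assume min: "minimal_monomial_generators (ideal_gen (?m ` T)) B"
  then obtain U where B: "B = ?m ` U"
    unfolding minimal_monomial_generators_def by (metis subset_imageE)
  have gen: "ideal_gen (?m ` U) = ideal_gen (?m ` T)"
    using min by (simp add: minimal_monomial_generators_def B)
  have "T \<subseteq> U"
  proof
    fix t
    assume t: "t \<in> T"
    have "?m t \<in> ideal_gen (?m ` T)"
      using t by (auto simp: monomial_in_monomial_ideal)
    then obtain s where s: "s \<in> U" "Poly_Mapping.lookup s \<le> Poly_Mapping.lookup t"
      by (auto simp: monomial_in_monomial_ideal simp flip: gen)
    have "?m s \<in> ideal_gen (?m ` U)"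
      using s by (auto simp: monomial_in_monomial_ideal)
    then obtain r where r: "r \<in> T" "Poly_Mapping.lookup r \<le> Poly_Mapping.lookup s"
      by (auto simp: monomial_in_monomial_ideal gen)
    then have "r = t"
      using anti s t by (meson order_trans)
    then have "s = t"
      using r s by (intro poly_mapping_eqI) (simp add: le_fun_def order_antisym)
    then show "t \<in> U"
      using s by simp
  qed
  then have "?m ` T \<subseteq> B"
    by (auto simp: B)
  then show "B = ?m ` T"
    using min unfolding minimal_monomial_generators_def by blast
next
  let ?m = "monomial :: _ \<Rightarrow> ('v, 'k) mpoly"
  assume B: "B = ?m ` T"
  have "ideal_gen B' \<noteq> ideal_gen (?m ` T)" if sub: "B' \<subset> ?m ` T" for B'
  proof
    assume eq: "ideal_gen B' = ideal_gen (?m ` T)"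
    obtain U where U: "U \<subseteq> T" "B' = ?m ` U"
      using sub by (meson psubset_imp_subset subset_imageE)
    then obtain t where t: "t \<in> T" "t \<notin> U"
      using sub by blast
    have "?m t \<in> ideal_gen (?m ` T)"
      using t by (auto simp: monomial_in_monomial_ideal)
    then obtain s where "s \<in> U" "Poly_Mapping.lookup s \<le> Poly_Mapping.lookup t"
      by (auto simp: monomial_in_monomial_ideal U simp flip: eq)
    then show False
      using anti U t by blast
  qed
  then show "minimal_monomial_generators (ideal_gen (?m ` T)) B"
    by (auto simp: minimal_monomial_generators_def B)
qed

section \<open>Powers of the edge ideal in terms of b-matchings\<close>

definition exponents :: "'v::finite set multiset \<Rightarrow> 'v \<Rightarrow>\<^sub>0 nat" where
  "exponents M = Abs_poly_mapping (mdeg M)"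

text \<open>The vertex type is finite, so every function has finite support and
  \<open>Abs_poly_mapping\<close> loses nothing.\<close>

lemma lookup_exponents [simp]: "Poly_Mapping.lookup (exponents M) = mdeg M"
  by (simp add: exponents_def Abs_poly_mapping_inverse)

lemma exponents_empty [simp]: "exponents {#} = 0"
  by (rule poly_mapping_eqI) simp

lemma exponents_union: "exponents (M + N) = exponents M + exponents N"
  by (rule poly_mapping_eqI) (simp add: lookup_add mdeg_union)

text \<open>The definition of \<open>edge_ideal\<close> lets \<open>u\<close> and \<open>v\<close>
  coincide. Cardinality two excludes such squares, in which \<open>mdeg\<close> would count the
  vertex only once.\<close>

lemma edge_ideal_eq:
  fixes E :: "'v::finite set set"
  assumes two: "\<forall>e\<in>E. card e = 2"
  shows "edge_ideal E = (ideal_gen (monomial ` exponents ` (\<lambda>e. {#e#}) ` E) :: ('v, 'k::field) mpoly set)"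
proof -
  have *: "var u * var v = (monomial (exponents {#{u, v}#}) :: ('v, 'k) mpoly)" if "{u, v} \<in> E" for u v
  proof -
    have "u \<noteq> v"
      using two that by fastforce
    then have "Poly_Mapping.single u 1 + Poly_Mapping.single v 1 = exponents {#{u, v}#}"
      by (intro poly_mapping_eqI) (auto simp: lookup_add lookup_single mdeg_add_mset when_def)
    then show ?thesis
      by (simp add: var_def monomial_mult)
  qed
  have "{var u * var v | u v. {u, v} \<in> E}
      = (monomial ` exponents ` (\<lambda>e. {#e#}) ` E :: ('v, 'k) mpoly set)" (is "?L = ?R")
  proof
    show "?L \<subseteq> ?R"
      using * by auto
    show "?R \<subseteq> ?L"
    proof clarify
      fix e
      assume e: "e \<in> E"
      then obtain u v where "e = {u, v}"
        using two by (meson card_2_iff)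
      then show "\<exists>u v. monomial (exponents {#e#}) = (var u * var v :: ('v, 'k) mpoly) \<and> {u, v} \<in> E"
        using * e by metis
    qed
  qed
  then show ?thesis
    by (simp add: edge_ideal_def)
qed

lemma ideal_power_edge_ideal:
  fixes E :: "'v::finite set set"
  assumes two: "\<forall>e\<in>E. card e = 2"
  shows "ideal_power (edge_ideal E) q
    = (ideal_gen (monomial ` exponents ` {M. set_mset M \<subseteq> E \<and> size M = q}) :: ('v, 'k::field) mpoly set)"
proof (induction q)
  case 0
  \<comment> \<open>The zero exponent lies below everything, so the zeroth power is the whole
    ring.\<close>
  have "{M. set_mset M \<subseteq> E \<and> size M = 0} = {{#}}"
    by auto
  then show ?case
    unfolding monomial_ideal by (simp add: le_fun_def)
next
  case (Suc q)
  have "{s + t |s t. s \<in> exponents ` (\<lambda>e. {#e#}) ` E \<and> t \<in> exponents ` {M. set_mset M \<subseteq> E \<and> size M = q}}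
      = exponents ` {M. set_mset M \<subseteq> E \<and> size M = Suc q}" (is "?L = ?R")
  proof
    have "exponents {#e#} + exponents M = exponents (add_mset e M)" for e and M :: "'v set multiset"
      by (simp flip: exponents_union)
    then show "?L \<subseteq> ?R"
      by auto
    show "?R \<subseteq> ?L"
    proof clarify
      fix M :: "'v set multiset"
      assume M: "set_mset M \<subseteq> E" "size M = Suc q"
      then obtain e N where N: "M = add_mset e N"
        by (meson size_eq_Suc_imp_eq_union)
      then have "exponents M = exponents {#e#} + exponents N"
        by (simp flip: exponents_union)
      then show "\<exists>s t. exponents M = s + t \<and> s \<in> exponents ` (\<lambda>e. {#e#}) ` E
          \<and> t \<in> exponents ` {M. set_mset M \<subseteq> E \<and> size M = q}"
        using M N by (intro exI[of _ "exponents {#e#}"] exI[of _ "exponents N"]) auto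
    qed
  qed
  then show ?case
    unfolding ideal_power.simps Suc unfolding edge_ideal_eq[OF two] ideal_mult_monomial by simp
qed

text \<open>A bounded monomial in the power lies above the exponents of some multiset of
  \<open>q\<close> edges. Its degrees are then bounded too, so it is a b-matching, and the monomials
  of b-matchings already generate.\<close>

lemma bounded_part_ideal_power:
  fixes E :: "'v::finite set set"
  assumes two: "\<forall>e\<in>E. card e = 2"
  shows "bounded_part c (ideal_power (edge_ideal E) q)
    = (ideal_gen (monomial ` exponents ` {M. b_matching E c M \<and> size M = q}) :: ('v, 'k::field) mpoly set)"
    (is "_ = ideal_gen (monomial ` ?T)")
proof -
  have "bounded_part c (ideal_power (edge_ideal E) q) =
     (ideal_gen (monomial ` {a. (\<exists>s\<in>exponents ` {M. set_mset M \<subseteq> E \<and> size M = q}.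
        Poly_Mapping.lookup s \<le> Poly_Mapping.lookup a) \<and> (\<forall>v. Poly_Mapping.lookup a v \<le> c v)})
        :: ('v, 'k) mpoly set)" (is "_ = ideal_gen (monomial ` ?A)")
    unfolding bounded_part_def ideal_power_edge_ideal[OF two] monomial_in_monomial_ideal
      setcompr_eq_image ..
  also have "\<dots> = ideal_gen (monomial ` ?T)"
  proof -
    have "\<exists>s\<in>?T. Poly_Mapping.lookup s \<le> Poly_Mapping.lookup a" if a: "a \<in> ?A" for a
    proof -
      obtain M where M: "set_mset M \<subseteq> E" "size M = q" "mdeg M \<le> Poly_Mapping.lookup a"
          and "Poly_Mapping.lookup a \<le> c"
        using a by (auto simp: le_fun_def)
      then have "b_matching E c M"
        by (auto simp: b_matching_def)
      then show ?thesis
        using M by auto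
    qed
    moreover have "?T \<subseteq> ?A"
      by (auto simp: b_matching_def le_fun_def)
    ultimately have "(\<exists>s\<in>?A. Poly_Mapping.lookup s \<le> Poly_Mapping.lookup t) \<longleftrightarrow> (\<exists>s\<in>?T. Poly_Mapping.lookup s \<le> Poly_Mapping.lookup t)" for t
      by (meson order_trans subsetD)
    then show ?thesis
      unfolding monomial_ideal by simp
  qed
  finally show ?thesis .
qed

lemma bounded_part_nonzero_iff:
  fixes E :: "'v::finite set set"
  assumes two: "\<forall>e\<in>E. card e = 2"
  shows "bounded_part c (ideal_power (edge_ideal E) q) \<noteq> ({0} :: ('v, 'k::field) mpoly set)
    \<longleftrightarrow> (\<exists>M. b_matching E c M \<and> size M = q)"
proof (cases "\<exists>M. b_matching E c M \<and> size M = q")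
  case True
  then obtain M where M: "b_matching E c M" "size M = q"
    by blast
  have "(monomial (exponents M) :: ('v, 'k) mpoly) \<in> bounded_part c (ideal_power (edge_ideal E) q)"
    unfolding bounded_part_ideal_power[OF two] monomial_in_monomial_ideal using M by blast
  moreover have "(monomial (exponents M) :: ('v, 'k) mpoly) \<noteq> 0"
    by (metis empty_iff insertI1 keys_monomial keys_zero)
  ultimately show ?thesis
    using True by blast
next
  case False
  then have none: "{M. b_matching E c M \<and> size M = q} = {}"
    by blast
  have "bounded_part c (ideal_power (edge_ideal E) q) = ({0} :: ('v, 'k) mpoly set)"
    unfolding bounded_part_ideal_power[OF two] none by (simp add: ideal_gen_def)
  then show ?thesis
    using False by blast
qed

text \<open>The top generators are the monomials of the maximum b-matchings, and the exchange lemma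
  extends the description of their divisors to all b-matchings. The assumption \<open>ne\<close>
  provides a positive size for \<open>delta\<close> to range over.\<close>

lemma divisor_vectors_eq:
  fixes E :: "'v::finite set set"
  assumes two: "\<forall>e\<in>E. card e = 2" and ne: "\<exists>M. b_matching E c M \<and> 1 \<le> size M"
  shows "divisor_vectors TYPE('k::field) E c
    = {\<chi> v. real (f v) | f. \<exists>M. b_matching E c M \<and> f \<le> mdeg M}"
proof -
  define I :: "('v, 'k) mpoly set" where "I = edge_ideal E"
  define d where "d = delta c I"
  define maxm where "maxm = {M. b_matching E c M \<and> size M = d}"
  have d_def': "d = (GREATEST q. 1 \<le> q \<and> (\<exists>M. b_matching E c M \<and> size M = q))"
    unfolding d_def delta_def I_def bounded_part_nonzero_iff[OF two] ..
  have bound: "q \<le> sum c UNIV" if "1 \<le> q \<and> (\<exists>M. b_matching E c M \<and> size M = q)" for q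
    using that size_b_matching[OF two] by fastforce
  have "\<exists>q. 1 \<le> q \<and> (\<exists>M. b_matching E c M \<and> size M = q)"
    using ne by blast
  then have d: "\<exists>M. b_matching E c M \<and> size M = d"
    using GreatestI_ex_nat[of "\<lambda>q. 1 \<le> q \<and> (\<exists>M. b_matching E c M \<and> size M = q)"] bound
    unfolding d_def' by blast
  \<comment> \<open>Only positive sizes compete in \<open>delta\<close>, so the empty b-matching is
    treated apart.\<close>
  have dmax: "size M \<le> d" if "b_matching E c M" for M
  proof (cases "size M = 0")
    case False
    then have "1 \<le> size M"
      by linarith
    then have "1 \<le> size M \<and> (\<exists>N. b_matching E c N \<and> size N = size M)"
      using that by blast
    then show ?thesis
      unfolding d_def' using bound by (intro Greatest_le_nat[of _ _ "sum c UNIV"]) blast+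
  qed simp
  \<comment> \<open>b-matchings of equal size have equal degree sums, so a pointwise inequality
    between their degrees is an equality.\<close>
  have anti: "s = t" if s: "s \<in> exponents ` maxm" and t: "t \<in> exponents ` maxm"
    and le: "Poly_Mapping.lookup s \<le> Poly_Mapping.lookup t" for s t
  proof -
    obtain M where M: "s = exponents M" "M \<in> maxm"
      using s by blast
    obtain N where N: "t = exponents N" "N \<in> maxm"
      using t by blast
    have "\<forall>e\<in>#M. card e = 2" "\<forall>e\<in>#N. card e = 2"
      using M N two by (auto simp: maxm_def b_matching_def)
    then have "sum (mdeg M) UNIV = sum (mdeg N) UNIV"
      using M N by (simp add: sum_mdeg maxm_def)
    moreover have "mdeg M \<le> mdeg N"
      using le M N by simp
    ultimately have "mdeg M v = mdeg N v" for v
      using sum_mono_inv[of "mdeg M" UNIV "mdeg N" v] by (simp add: le_fun_def)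
    then show ?thesis
      by (intro poly_mapping_eqI) (simp add: M N)
  qed
  have "top_generators E c = (monomial ` exponents ` maxm :: ('v, 'k) mpoly set)"
    unfolding top_generators_def Let_def I_def[symmetric] d_def[symmetric]
    unfolding I_def bounded_part_ideal_power[OF two] maxm_def[symmetric]
    by (rule the_equality) (simp_all add: minimal_monomial_generators_antichain[OF anti])
  then have "divisor_vectors TYPE('k) E c = {\<chi> v. real (Poly_Mapping.lookup a v) | a. \<exists>M\<in>maxm. Poly_Mapping.lookup a \<le> mdeg M}"
    unfolding divisor_vectors_def by (simp add: monomial_dvd_monomial)
  also have "\<dots> = {\<chi> v. real (f v) | f. \<exists>M\<in>maxm. f \<le> mdeg M}"
  proof -
    have "\<exists>a. Poly_Mapping.lookup a = f" for f :: "'v \<Rightarrow> nat"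
      by (metis Abs_poly_mapping_inverse finite_class.finite mem_Collect_eq)
    then show ?thesis
      by metis
  qed
  also have "\<dots> = {\<chi> v. real (f v) | f. \<exists>M. b_matching E c M \<and> f \<le> mdeg M}"
  proof -
    have "\<exists>N\<in>maxm. mdeg M \<le> mdeg N" if M: "b_matching E c M" for M
    proof -
      obtain N where "b_matching E c N" "\<And>L. b_matching E c L \<Longrightarrow> size L \<le> size N" "mdeg M \<le> mdeg N"
        using b_matching_dominated_by_maximum[OF two M] by blast
      moreover from this d dmax have "size N = d"
        by (metis le_antisym)
      ultimately show ?thesis
        unfolding maxm_def by blast
    qed
    then have "(\<exists>M\<in>maxm. f \<le> mdeg M) \<longleftrightarrow> (\<exists>M. b_matching E c M \<and> f \<le> mdeg M)" for f
      unfolding maxm_def by (blast intro: order_trans)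
    then show ?thesis
      by simp
  qed
  finally show ?thesis .
qed

section \<open>Reflexive polytopes and cubes\<close>

lemma lattice_polytope_convex_hull:
  assumes "finite S" "S \<subseteq> lattice_points"
  shows "lattice_polytope (convex hull S)"
  using assms extreme_points_of_convex_hull[of S] unfolding lattice_polytope_def polytope_def by blast

lemma lattice_inner_Ints:
  assumes "x \<in> lattice_points" "y \<in> lattice_points"
  shows "x \<bullet> y \<in> \<int>"
  using assms unfolding inner_vec_def lattice_points_def by (auto intro!: Ints_sum)

text \<open>The dual of a polytope around the origin has the scaled facet normals as vertices, so every
  facet of a reflexive polytope lies at lattice distance one from the origin. A facet enters as a
  set \<open>F\<close> of points determining its normal up to a scalar.\<close>

lemma facet_height:
  fixes P :: "(real ^ 'v::finite) set"
  assumes refl: "reflexive_polytope ((\<lambda>x. real d *\<^sub>R x - a) ` P)"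
    and "d > 0" and a: "a \<in> lattice_points"
    and w: "w \<in> lattice_points" "\<bar>w $ v\<bar> = 1" and b: "b \<in> \<int>"
    and le: "\<And>x. x \<in> P \<Longrightarrow> w \<bullet> x \<le> b"
    and F: "F \<subseteq> P" "F \<noteq> {}" "\<And>x. x \<in> F \<Longrightarrow> w \<bullet> x = b"
    and normal: "\<And>p. \<forall>x\<in>F. \<forall>y\<in>F. p \<bullet> x = p \<bullet> y \<Longrightarrow> \<exists>l. p = l *\<^sub>R w"
  shows "real d * b - w \<bullet> a = 1"
proof -
  define Q where "Q = (\<lambda>x. real d *\<^sub>R x - a) ` P"
  \<comment> \<open>The value of \<open>w\<close> on the facet after dilation and translation; the
    claim is that it equals one.\<close>
  define h where "h = real d * b - w \<bullet> a"
  have Q: "0 \<in> interior Q" "lattice_polytope (dual Q)"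
    using refl by (simp_all add: reflexive_polytope_def Q_def)
  have w0: "w \<noteq> 0"
    using w(2) by auto
  have Qle: "w \<bullet> y \<le> h" if "y \<in> Q" for y
    using that le \<open>d > 0\<close> by (auto simp: Q_def h_def inner_diff_right intro: mult_left_mono)
  \<comment> \<open>The origin being interior, a small positive multiple of \<open>w\<close> lies in
    \<open>Q\<close>.\<close>
  have "h > 0"
  proof -
    obtain e where e: "e > 0" "ball 0 e \<subseteq> Q"
      using Q(1) by (meson mem_interior)
    define y where "y = (e / 2 / norm w) *\<^sub>R w"
    have "y \<in> ball 0 e"
      using e(1) w0 by (simp add: y_def)
    then have "w \<bullet> y \<le> h"
      using e(2) Qle by blast
    moreover have "w \<bullet> y > 0"
      using e(1) w0 by (simp add: y_def)
    ultimately show ?thesis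
      by simp
  qed
  \<comment> \<open>The normal is scaled so that the facet lies at value one; by
    \<open>normal\<close> no other vector pairs to one with all of the facet.\<close>
  define u where "u = (1 / h) *\<^sub>R w"
  have "u \<in> dual Q"
    using Qle \<open>h > 0\<close> by (simp add: dual_def u_def divide_simps)
  have Fy: "real d *\<^sub>R x - a \<in> Q" "u \<bullet> (real d *\<^sub>R x - a) = 1" if "x \<in> F" for x
  proof -
    show "real d *\<^sub>R x - a \<in> Q"
      using that F(1) by (auto simp: Q_def)
    have "w \<bullet> (real d *\<^sub>R x - a) = h"
      using F(3)[OF that] by (simp add: h_def inner_diff_right)
    then show "u \<bullet> (real d *\<^sub>R x - a) = 1"
      using \<open>h > 0\<close> by (simp add: u_def)
  qed
  have unique: "p = u" if p: "\<And>x. x \<in> F \<Longrightarrow> p \<bullet> (real d *\<^sub>R x - a) = 1" for p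
  proof -
    have px: "p \<bullet> x = (1 + p \<bullet> a) / real d" if "x \<in> F" for x
      using p[OF that] \<open>d > 0\<close> by (simp add: inner_diff_right field_simps)
    have "\<forall>x\<in>F. \<forall>y\<in>F. p \<bullet> x = p \<bullet> y"
      by (metis px)
    then obtain l where l: "p = l *\<^sub>R w"
      using normal by blast
    obtain x where x: "x \<in> F"
      using F(2) by blast
    have "w \<bullet> (real d *\<^sub>R x - a) = h"
      by (simp add: h_def inner_diff_right F(3)[OF x])
    then have "l * h = 1"
      using p[OF x] by (simp add: l)
    then have "l = 1 / h"
      using \<open>h > 0\<close> by (simp add: eq_divide_eq)
    then show ?thesis
      by (simp add: l u_def)
  qed
  have "u extreme_point_of dual Q"
    unfolding extreme_point_of_def
  proof (intro conjI ballI notI)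
    show "u \<in> dual Q" by fact
    fix p q
    assume p: "p \<in> dual Q" and q: "q \<in> dual Q" and "u \<in> open_segment p q"
    then obtain t where t: "p \<noteq> q" "0 < t" "t < 1" "u = (1 - t) *\<^sub>R p + t *\<^sub>R q"
      by (auto simp: in_segment)
    \<comment> \<open>A mean with positive weights of two numbers that are at most one equals one
      only if both do.\<close>
    have "p \<bullet> (real d *\<^sub>R x - a) = 1 \<and> q \<bullet> (real d *\<^sub>R x - a) = 1" if x: "x \<in> F" for x
    proof -
      define y where "y = real d *\<^sub>R x - a"
      have "p \<bullet> y \<le> 1" "q \<bullet> y \<le> 1"
        using p q Fy(1)[OF x] by (auto simp: dual_def y_def)
      moreover have "(1 - t) * (1 - p \<bullet> y) + t * (1 - q \<bullet> y) = 0"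
        using Fy(2)[OF x] by (simp add: t(4) y_def[symmetric] inner_add_left algebra_simps)
      ultimately have "(1 - t) * (1 - p \<bullet> y) = 0" "t * (1 - q \<bullet> y) = 0"
        using t by (smt (verit) mult_nonneg_nonneg)+
      then show ?thesis
        using t by (simp add: y_def)
    qed
    then have "p = u" "q = u"
      using unique by blast+
    then show False
      using t(1) by simp
  qed
  then have "u \<in> lattice_points"
    using Q(2) by (auto simp: lattice_polytope_def)
  \<comment> \<open>As \<open>w $ v\<close> is a unit, integrality of \<open>u\<close> forces
    \<open>h\<close> to be at most one, while \<open>h\<close> is itself a positive integer.\<close>
  then have "w $ v / h \<in> \<int>"
    by (auto simp: u_def lattice_points_def dest: spec[of _ v])
  then have "\<bar>w $ v / h\<bar> \<ge> 1"
    using w(2) \<open>h > 0\<close> by (intro Ints_nonzero_abs_ge1) auto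
  then have "h \<le> 1"
    using w(2) \<open>h > 0\<close> by (simp add: abs_divide divide_simps split: if_splits)
  moreover have "h \<in> \<int>"
    unfolding h_def using b lattice_inner_Ints[OF w(1) a] by simp
  then have "h \<ge> 1"
    using \<open>h > 0\<close> Ints_nonzero_abs_ge1[of h] by simp
  ultimately show ?thesis
    by (simp add: h_def)
qed

section \<open>Cubes and their duals\<close>

lemma unit_cube_eq_cbox: "unit_cube = cbox (0 :: real ^ 'v::finite) 1"
  by (simp add: unit_cube_def set_eq_iff mem_box_cart)

lemma finite_vec_all:
  assumes "finite A"
  shows "finite {x :: 'a ^ 'v::finite. \<forall>i. x $ i \<in> A}"
proof (rule finite_subset)
  show "{x :: 'a ^ 'v. \<forall>i. x $ i \<in> A} \<subseteq> vec_lambda ` (UNIV \<rightarrow>\<^sub>E A)"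
  proof
    fix x :: "'a ^ 'v"
    assume "x \<in> {x. \<forall>i. x $ i \<in> A}"
    then show "x \<in> vec_lambda ` (UNIV \<rightarrow>\<^sub>E A)"
      by (intro image_eqI[of _ _ "vec_nth x"]) auto
  qed
  show "finite (vec_lambda ` (UNIV \<rightarrow>\<^sub>E A) :: ('a ^ 'v) set)"
    using assms by (intro finite_imageI finite_PiE) auto
qed

lemma unit_cube_convex_hull_vec:
  "unit_cube = convex hull {x :: real ^ 'v::finite. \<forall>i. x $ i = 0 \<or> x $ i = 1}"
  unfolding unit_cube_eq_cbox Cart_1 unit_interval_convex_hull
  by (rule arg_cong[of _ _ "(hull) convex"]) (simp add: Basis_vec_def inner_axis)

lemma lattice_polytope_affine_cube:
  assumes "t \<in> lattice_points"
  shows "lattice_polytope ((\<lambda>x. t + real m *\<^sub>R x) ` (unit_cube :: (real ^ 'v::finite) set))"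
proof -
  have "finite {x :: real ^ 'v. \<forall>i. x $ i \<in> {0, 1}}"
    by (rule finite_vec_all) simp
  then have "finite {x :: real ^ 'v. \<forall>i. x $ i = 0 \<or> x $ i = 1}"
    by simp
  moreover have "(\<lambda>x. t + real m *\<^sub>R x) ` {x :: real ^ 'v. \<forall>i. x $ i = 0 \<or> x $ i = 1} \<subseteq> lattice_points"
    using assms by (auto simp: lattice_points_def) (metis Ints_0 Ints_1 Ints_add Ints_mult Ints_of_nat)
  ultimately show ?thesis
    unfolding unit_cube_convex_hull_vec convex_hull_affinity[symmetric]
    by (intro lattice_polytope_convex_hull) auto
qed

lemma mem_centered_cube: "x \<in> centered_cube \<longleftrightarrow> (\<forall>i. \<bar>x $ i\<bar> \<le> 1)"
proof
  assume "\<forall>i. \<bar>x $ i\<bar> \<le> 1"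
  then have "(1 / 2) *\<^sub>R (x + 1) \<in> unit_cube"
    by (auto simp: unit_cube_def abs_le_iff field_simps) (smt (verit))
  moreover have "x = 2 *\<^sub>R ((1 / 2) *\<^sub>R (x + 1)) - 1"
    by simp
  ultimately show "x \<in> centered_cube"
    unfolding centered_cube_def by blast
qed (auto simp: centered_cube_def unit_cube_def abs_le_iff)

lemma centered_cube_eq_cbox: "centered_cube = cbox (-1 :: real ^ 'v::finite) 1"
  by (simp add: set_eq_iff mem_centered_cube mem_box_cart abs_le_iff) (smt (verit))

lemma aff_dim_cbox_vec:
  fixes l u :: "real ^ 'v::finite"
  assumes "\<And>i. l $ i < u $ i"
  shows "aff_dim (cbox l u) = int CARD('v)"
proof -
  have "box l u \<noteq> {}"
    using assms by (simp add: interval_ne_empty_cart)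
  then show ?thesis
    using aff_dim_nonempty_interior[of "cbox l u"] by (simp add: interior_cbox)
qed

text \<open>The dual of the cube is the cross-polytope. Pairing \<open>x\<close> with its sign
  vector, a point of the cube, bounds the sum \<open>s\<close> of absolute values by one; then
  \<open>x\<close> is \<open>s\<close> times a convex combination of signed unit vectors plus
  \<open>1 - s\<close> times the origin.\<close>

lemma dual_centered_cube:
  "dual centered_cube = convex hull ({axis i 1 | i. True} \<union> {- axis i 1 | i. True} :: (real ^ 'v::finite) set)"
    (is "_ = convex hull ?S")
proof
  have "dual centered_cube = (\<Inter>y\<in>centered_cube. {x :: real ^ 'v. y \<bullet> x \<le> 1})"
    by (auto simp: dual_def inner_commute)
  then have "convex (dual (centered_cube :: (real ^ 'v) set))"
    by (simp add: convex_INT convex_halfspace_le)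
  moreover have "?S \<subseteq> dual centered_cube"
    by (auto simp: dual_def mem_centered_cube inner_axis' abs_le_iff)
  ultimately show "convex hull ?S \<subseteq> dual centered_cube"
    by (simp add: hull_minimal)
  show "dual centered_cube \<subseteq> convex hull ?S"
  proof
    fix x :: "real ^ 'v"
    assume x: "x \<in> dual centered_cube"
    define s where "s = (\<Sum>i\<in>UNIV. \<bar>x $ i\<bar>)"
    have "(\<chi> i. sgn (x $ i)) \<in> (centered_cube :: (real ^ 'v) set)"
      by (simp add: mem_centered_cube abs_sgn_eq)
    then have "x \<bullet> (\<chi> i. sgn (x $ i)) \<le> 1"
      using x by (auto simp: dual_def)
    then have s1: "s \<le> 1"
      by (simp add: s_def inner_vec_def abs_sgn)
    have s0: "s \<ge> 0"
      by (simp add: s_def sum_nonneg)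
    have ax: "axis i 1 \<in> convex hull ?S" "- axis i 1 \<in> convex hull ?S" for i
      by (auto intro!: hull_inc)
    have zero: "0 \<in> convex hull ?S"
      using convexD[OF convex_convex_hull ax(1)[of undefined] ax(2)[of undefined], of "1/2" "1/2"] by simp
    have "s *\<^sub>R ((1 / s) *\<^sub>R x) + (1 - s) *\<^sub>R 0 \<in> convex hull ?S" if "s > 0"
    proof (rule convexD[OF convex_convex_hull _ zero])
      have "(\<Sum>i\<in>UNIV. (\<bar>x $ i\<bar> / s) *\<^sub>R (sgn (x $ i) *\<^sub>R axis i 1 :: real ^ 'v)) \<in> convex hull ?S"
      proof (rule convex_sum)
        show "(\<Sum>i\<in>UNIV. \<bar>x $ i\<bar> / s) = 1"
          using that by (simp add: s_def flip: sum_divide_distrib)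
        \<comment> \<open>A zero coordinate contributes the origin, which lies in the hull as the
          midpoint of opposite unit vectors.\<close>
        show "sgn (x $ i) *\<^sub>R axis i 1 \<in> convex hull ?S" for i
          using ax zero by (auto simp: sgn_if)
      qed (use s0 in auto)
      also have "(\<Sum>i\<in>UNIV. (\<bar>x $ i\<bar> / s) *\<^sub>R (sgn (x $ i) *\<^sub>R axis i 1 :: real ^ 'v)) = (1 / s) *\<^sub>R x"
      proof (rule vec_eq_iff[THEN iffD2], rule allI)
        fix j
        have "(\<Sum>i\<in>UNIV. (\<bar>x $ i\<bar> / s) *\<^sub>R (sgn (x $ i) *\<^sub>R axis i 1 :: real ^ 'v)) $ j
            = (\<Sum>i\<in>UNIV. if i = j then sgn (x $ i) * \<bar>x $ i\<bar> / s else 0)"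
          by (subst sum_component, rule sum.cong) (auto simp: axis_def)
        also have "\<dots> = ((1 / s) *\<^sub>R x) $ j"
          by (simp add: sgn_mult_abs)
        finally show "(\<Sum>i\<in>UNIV. (\<bar>x $ i\<bar> / s) *\<^sub>R (sgn (x $ i) *\<^sub>R axis i 1 :: real ^ 'v)) $ j
            = ((1 / s) *\<^sub>R x) $ j" .
      qed
      finally show "(1 / s) *\<^sub>R x \<in> convex hull ?S" .
    qed (use s0 s1 in auto)
    moreover have "x = 0" if "s = 0"
      using that by (simp add: s_def sum_nonneg_eq_0_iff vec_eq_iff)
    ultimately show "x \<in> convex hull ?S"
      using s0 zero by fastforce
  qed
qed

lemma reflexive_centered_cube: "reflexive_polytope (centered_cube :: (real ^ 'v::finite) set)"
  unfolding reflexive_polytope_def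
proof (intro conjI)
  have "centered_cube = (\<lambda>x. - 1 + real 2 *\<^sub>R x) ` (unit_cube :: (real ^ 'v) set)"
    by (simp add: centered_cube_def)
  moreover have "lattice_polytope ((\<lambda>x. - 1 + real 2 *\<^sub>R x) ` (unit_cube :: (real ^ 'v) set))"
    by (rule lattice_polytope_affine_cube) (simp add: lattice_points_def)
  ultimately show "lattice_polytope (centered_cube :: (real ^ 'v) set)"
    by simp
  show "aff_dim (centered_cube :: (real ^ 'v) set) = int CARD('v)"
    unfolding centered_cube_eq_cbox by (rule aff_dim_cbox_vec) simp
  show "0 \<in> interior (centered_cube :: (real ^ 'v) set)"
    by (simp add: centered_cube_eq_cbox interior_cbox mem_box_cart)
  show "lattice_polytope (dual (centered_cube :: (real ^ 'v) set))"
    unfolding dual_centered_cube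
    by (rule lattice_polytope_convex_hull)
      (auto simp: lattice_points_def axis_def full_SetCompr_eq)
qed

lemma gorenstein_scaled_cube:
  assumes "m = 1 \<or> m = 2"
  shows "gorenstein_polytope ((*\<^sub>R) (real m) ` (unit_cube :: (real ^ 'v::finite) set))"
  unfolding gorenstein_polytope_def
proof (intro conjI)
  show "lattice_polytope ((*\<^sub>R) (real m) ` (unit_cube :: (real ^ 'v) set))"
    using lattice_polytope_affine_cube[of 0 m] by (simp add: lattice_points_def)
  have "aff_dim ((*\<^sub>R) (real m) ` (unit_cube :: (real ^ 'v) set)) = aff_dim (unit_cube :: (real ^ 'v) set)"
    using assms by (intro aff_dim_injective_linear_image linear_scaleR) (auto simp: inj_on_def)
  also have "\<dots> = int CARD('v)"
    unfolding unit_cube_eq_cbox by (rule aff_dim_cbox_vec) simp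
  finally show "aff_dim ((*\<^sub>R) (real m) ` (unit_cube :: (real ^ 'v) set)) = int CARD('v)" .
  \<comment> \<open>For both values of \<open>m\<close> the factor \<open>3 - m\<close> equals
    \<open>2 / m\<close>, so the dilated cube has side two and subtracting the all-one vector
    centres it.\<close>
  have "real (3 - m) * real m = 2"
    using assms by (auto simp del: of_nat_diff)
  then have "(\<lambda>x. real (3 - m) *\<^sub>R x - 1) ` (*\<^sub>R) (real m) ` unit_cube = (centered_cube :: (real ^ 'v) set)"
    by (simp add: centered_cube_def image_image del: of_nat_diff)
  then have "reflexive_polytope ((\<lambda>x. real (3 - m) *\<^sub>R x - 1) ` (*\<^sub>R) (real m) ` (unit_cube :: (real ^ 'v) set))"
    by (simp add: reflexive_centered_cube)
  moreover have "(1 :: real ^ 'v) \<in> lattice_points"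
    by (simp add: lattice_points_def)
  moreover have "3 - m > 0"
    using assms by auto
  ultimately show "\<exists>d::nat. d > 0 \<and> (\<exists>a\<in>lattice_points.
      reflexive_polytope ((\<lambda>x. real d *\<^sub>R x - a) ` (*\<^sub>R) (real m) ` (unit_cube :: (real ^ 'v) set)))"
    by blast
qed

section \<open>Whiskered graphs\<close>

text \<open>As soon as a nonempty b-matching exists, \<open>divisor_vectors_eq\<close> identifies
  these with the divisor vectors, with no field and no maximality in the description.\<close>

definition bounded_degrees :: "'v set set \<Rightarrow> ('v \<Rightarrow> nat) \<Rightarrow> ('v \<Rightarrow> nat) set" where
  "bounded_degrees E c = {f. \<exists>M. b_matching E c M \<and> f \<le> mdeg M}"

definition real_vec :: "('v \<Rightarrow> nat) \<Rightarrow> real ^ 'v" where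
  "real_vec f = (\<chi> v. real (f v))"

lemma real_vec_nth [simp]: "real_vec f $ v = real (f v)"
  by (simp add: real_vec_def)

lemma bounded_degrees_le: "f \<in> bounded_degrees E c \<Longrightarrow> f v \<le> c v"
  unfolding bounded_degrees_def b_matching_def le_fun_def by (blast intro: order_trans)

section \<open>Facets and the equations that reflexivity imposes on them\<close>

lemma convex_hull_inner_le:
  assumes "x \<in> convex hull S" "\<And>y. y \<in> S \<Longrightarrow> w \<bullet> y \<le> b"
  shows "w \<bullet> x \<le> b"
proof -
  have "convex hull S \<subseteq> {y. w \<bullet> y \<le> b}"
    using assms(2) by (intro hull_minimal convex_halfspace_le) auto
  then show ?thesis
    using assms(1) by blast
qed

text \<open>The origin and the unit vectors other than that of \<open>v\<close> span the facet on
  which the coordinate at \<open>v\<close> vanishes. Its outer normal is the negative unit vector,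
  so its height after translation is \<open>a $ v\<close>.\<close>

lemma coordinate_facet:
  fixes D :: "('v::finite \<Rightarrow> nat) set"
  assumes refl: "reflexive_polytope ((\<lambda>x. real d *\<^sub>R x - a) ` (convex hull (real_vec ` D)))"
    and "d > 0" "a \<in> lattice_points"
    and D: "\<And>f. f \<le> (\<lambda>_. 1) \<Longrightarrow> f \<in> D"
  shows "a $ v = 1"
proof -
  define F where "F = insert 0 ((\<lambda>u. axis u 1) ` (- {v}) :: (real ^ 'v) set)"
  have "real d * 0 - (- axis v 1) \<bullet> a = 1"
  proof (rule facet_height[OF refl \<open>d > 0\<close> \<open>a \<in> lattice_points\<close>, where F = F and v = v])
    show "- axis v 1 \<in> lattice_points"
      by (simp add: lattice_points_def axis_def)
    show "(- axis v 1) \<bullet> x \<le> 0" if "x \<in> convex hull (real_vec ` D)" for x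
      using that by (rule convex_hull_inner_le) (auto simp: inner_axis')
    have "0 \<in> real_vec ` D"
      by (rule image_eqI[of _ _ "\<lambda>_. 0"], simp add: vec_eq_iff) (rule D, simp add: le_fun_def)
    moreover have "axis u 1 \<in> real_vec ` D" for u
      by (rule image_eqI[of _ _ "\<lambda>w. if w = u then 1 else 0"], simp add: vec_eq_iff axis_def)
        (rule D, simp add: le_fun_def)
    ultimately have "F \<subseteq> real_vec ` D"
      by (auto simp: F_def)
    then show "F \<subseteq> convex hull (real_vec ` D)"
      by (rule order_trans) (rule hull_subset)
    show "\<bar>(- axis v 1 :: real ^ 'v) $ v\<bar> = 1"
      by (simp add: axis_def)
    show "(- axis v 1) \<bullet> x = 0" if "x \<in> F" for x
      using that by (auto simp: F_def inner_axis_axis split: if_splits)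
    fix p :: "real ^ 'v"
    assume p: "\<forall>x\<in>F. \<forall>y\<in>F. p \<bullet> x = p \<bullet> y"
    have "p $ u = 0" if "u \<noteq> v" for u
      using p that by (force simp: F_def inner_axis)
    then have "p = (- (p $ v)) *\<^sub>R (- axis v 1)"
      by (auto simp: vec_eq_iff axis_def)
    then show "\<exists>l. p = l *\<^sub>R (- axis v 1)"
      by blast
  qed (auto simp: F_def)
  then show ?thesis
    by (simp add: inner_axis')
qed

text \<open>The face where the coordinate sum over \<open>A\<close> reaches \<open>B\<close> is a
  facet, since it contains as many affinely independent points as there are coordinates:
  \<open>B\<close> units at \<open>u\<close>, the same with one more unit outside \<open>A\<close>,
  and the same with one unit moved from \<open>u\<close> within \<open>A\<close>.\<close>

lemma rank_facet:
  fixes D :: "('v::finite \<Rightarrow> nat) set"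
  assumes refl: "reflexive_polytope ((\<lambda>x. real d *\<^sub>R x - a) ` (convex hull (real_vec ` D)))"
    and "d > 0" "a \<in> lattice_points"
    and le: "\<And>f. f \<in> D \<Longrightarrow> sum f A \<le> B"
    and u: "u \<in> A" and "B > 0"
    and base: "(\<lambda>w. if w = u then B else 0) \<in> D"
    and outside: "\<And>v. v \<notin> A \<Longrightarrow> (\<lambda>w. if w = u then B else if w = v then 1 else 0) \<in> D"
    and inside: "\<And>v. v \<in> A \<Longrightarrow> v \<noteq> u \<Longrightarrow> (\<lambda>w. if w = u then B - 1 else if w = v then 1 else 0) \<in> D"
  shows "real d * real B - (\<Sum>v\<in>A. a $ v) = 1"
proof -
  define F :: "(real ^ 'v) set" where "F = insert (real B *\<^sub>R axis u 1)
     ((\<lambda>v. real B *\<^sub>R axis u 1 + axis v 1) ` (- A) \<union> (\<lambda>v. real (B - 1) *\<^sub>R axis u 1 + axis v 1) ` (A - {u}))"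
  define w :: "real ^ 'v" where "w = (\<chi> v. if v \<in> A then 1 else 0)"
  have w: "w \<bullet> x = (\<Sum>v\<in>A. x $ v)" for x
    by (simp add: w_def inner_vec_def if_distrib[of "\<lambda>c. c * _"] sum.If_cases cong: if_cong)
  have "real d * real B - w \<bullet> a = 1"
  proof (rule facet_height[OF refl \<open>d > 0\<close> \<open>a \<in> lattice_points\<close>, where F = F and v = u])
    show "w \<in> lattice_points"
      by (simp add: lattice_points_def w_def)
    show "w \<bullet> x \<le> real B" if "x \<in> convex hull (real_vec ` D)" for x
      using that
    proof (rule convex_hull_inner_le)
      show "w \<bullet> y \<le> real B" if "y \<in> real_vec ` D" for y
        using that le by (auto simp: w simp flip: of_nat_sum)
    qed
    have eq_base: "real B *\<^sub>R axis u 1 = real_vec (\<lambda>w. if w = u then B else 0)"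
      by (simp add: vec_eq_iff axis_def)
    have eq_outside: "real B *\<^sub>R axis u 1 + axis v 1 = real_vec (\<lambda>w. if w = u then B else if w = v then 1 else 0)"
      if "v \<notin> A" for v
      using that u by (auto simp: vec_eq_iff axis_def)
    have eq_inside: "real (B - 1) *\<^sub>R axis u 1 + axis v 1 = real_vec (\<lambda>w. if w = u then B - 1 else if w = v then 1 else 0)"
      if "v \<noteq> u" for v
      using that by (auto simp: vec_eq_iff axis_def)
    have "F \<subseteq> real_vec ` D"
      unfolding F_def
    proof (intro insert_subsetI Un_least image_subsetI)
      show "real B *\<^sub>R axis u 1 \<in> real_vec ` D"
        unfolding eq_base by (rule imageI[OF base])
      show "real B *\<^sub>R axis u 1 + axis v 1 \<in> real_vec ` D" if "v \<in> - A" for v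
        using that eq_outside[of v] outside[of v] by simp
      show "real (B - 1) *\<^sub>R axis u 1 + axis v 1 \<in> real_vec ` D" if "v \<in> A - {u}" for v
        using that by (subst eq_inside) (auto intro: inside)
    qed
    then show "F \<subseteq> convex hull (real_vec ` D)"
      by (rule order_trans) (rule hull_subset)
    show "w \<bullet> x = real B" if "x \<in> F" for x
    proof -
      have "w \<bullet> axis v 1 = (if v \<in> A then 1 else 0)" for v
        by (simp add: w_def inner_axis)
      then show ?thesis
        using that u \<open>B > 0\<close> by (auto simp: F_def inner_add_right)
    qed
    fix p :: "real ^ 'v"
    assume p: "\<forall>x\<in>F. \<forall>y\<in>F. p \<bullet> x = p \<bullet> y"
    have eq: "p \<bullet> x = real B * p $ u" if "x \<in> F" for x
    proof -
      have "real B *\<^sub>R axis u 1 \<in> F"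
        by (simp add: F_def)
      then have "p \<bullet> x = p \<bullet> (real B *\<^sub>R axis u 1)"
        using p that by blast
      then show ?thesis
        by (simp add: inner_axis)
    qed
    \<comment> \<open>Comparison with the base point: a unit added outside \<open>A\<close> must
      have weight zero, and a unit moved within \<open>A\<close> must keep the weight it has at
      \<open>u\<close>.\<close>
    have "p $ v = 0" if "v \<notin> A" for v
      using eq[of "real B *\<^sub>R axis u 1 + axis v 1"] that by (simp add: F_def inner_add_right inner_axis)
    moreover have "p $ v = p $ u" if "v \<in> A" for v
      using eq[of "real (B - 1) *\<^sub>R axis u 1 + axis v 1"] that \<open>B > 0\<close>
      by (cases "v = u") (simp_all add: F_def inner_add_right inner_axis of_nat_diff algebra_simps)
    ultimately have "p = (p $ u) *\<^sub>R w"
      by (simp add: vec_eq_iff w_def)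
    then show "\<exists>l. p = l *\<^sub>R w"
      by blast
  qed (use u in \<open>auto simp: w_def F_def\<close>)
  then show ?thesis
    by (simp add: w)
qed

section \<open>Degree vectors of whiskered graphs: constructions and bounds\<close>

lemma card_whisker:
  assumes "graph E"
  shows "\<forall>e\<in>whisker E. card e = 2"
  using assms by (auto simp: graph_def whisker_def card_image)

text \<open>Units are added one at a time where there is room. This serves to choose edge
  multiplicities with a prescribed total.\<close>

lemma ex_le_sum_eq:
  fixes g :: "'n::finite \<Rightarrow> nat"
  assumes "s \<le> sum g UNIV"
  shows "\<exists>k\<le>g. sum k UNIV = s"
  using assms
proof (induction s)
  case 0
  show ?case
    by (intro exI[of _ "\<lambda>_. 0"]) (simp add: le_fun_def)
next
  case (Suc s)
  then obtain k where k: "k \<le> g" "sum k UNIV = s"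
    by auto
  then obtain j where j: "k j < g j"
    using Suc.prems sum_mono[of UNIV g k] by (metis Suc_n_not_le_n order_trans not_le)
  have "sum (k(j := Suc (k j))) UNIV = Suc (sum k UNIV)"
    by (simp add: sum.remove[of UNIV j])
  then show ?case
    using k j by (intro exI[of _ "k(j := Suc (k j))"]) (auto simp: le_fun_def)
qed

text \<open>The b-matching takes \<open>t l\<close> copies of the whisker at \<open>l\<close> and
  \<open>k j\<close> copies of the edge from \<open>i\<close> to \<open>j\<close>; \<open>g\<close>
  is its degree vector. All later memberships in \<open>bounded_degrees\<close> reduce to a choice
  of \<open>t\<close> and \<open>k\<close>.\<close>

lemma star_degrees:
  fixes E :: "'n::finite set set"
  assumes E: "\<And>j. k j \<noteq> 0 \<Longrightarrow> {i, j} \<in> E" and k: "k i = 0"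
    and g: "g = case_sum (\<lambda>l. t l + (if l = i then sum k UNIV else k l)) t"
    and "g \<le> c" "f \<le> g"
  shows "f \<in> bounded_degrees (whisker E) c"
proof -
  define M :: "('n + 'n) set multiset" where
    "M = (\<Sum>l\<in>UNIV. replicate_mset (t l) {Inl l, Inr l}) + (\<Sum>j\<in>UNIV. replicate_mset (k j) {Inl i, Inl j})"
  have "{Inl i, Inl j} \<in> whisker E" if "k j \<noteq> 0" for j
  proof -
    have "{Inl i, Inl j} = Inl ` {i, j}"
      by simp
    then show ?thesis
      using E[OF that] unfolding whisker_def by blast
  qed
  then have "set_mset M \<subseteq> whisker E"
    by (auto simp: M_def set_mset_sum whisker_def split: if_splits)
  moreover have "mdeg M v = g v" for v
  proof (cases v)
    case (Inl l)
    have "(\<Sum>j\<in>UNIV. if l = i \<or> l = j then k j else 0) = (if l = i then sum k UNIV else k l)"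
      by simp
    moreover have "(\<Sum>x\<in>UNIV. if l = x then t x else 0) = t l"
      by simp
    ultimately show ?thesis
      by (simp add: Inl M_def mdeg_union mdeg_sum mdeg_replicate g cong: if_cong)
  next
    case (Inr l)
    then show ?thesis
      by (simp add: M_def mdeg_union mdeg_sum mdeg_replicate g)
  qed
  ultimately show ?thesis
    using assms unfolding bounded_degrees_def b_matching_def by (auto simp: le_fun_def)
qed

lemma whisker_degrees:
  fixes E :: "'n::finite set set"
  assumes "case_sum t t \<le> c" "f \<le> case_sum t t"
  shows "f \<in> bounded_degrees (whisker E) c"
  using assms by (intro star_degrees[of "\<lambda>_. 0" undefined E "case_sum t t" t]) (auto simp: fun_eq_iff split: sum.split)

text \<open>The only edge at a leaf is its whisker, which also uses up capacity at the other
  end.\<close>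

lemma leaf_degree_le:
  assumes "f \<in> bounded_degrees (whisker E) c"
  shows "f (Inr i) \<le> c (Inl i)"
proof -
  obtain M where M: "set_mset M \<subseteq> whisker E" "mdeg M \<le> c" "f \<le> mdeg M"
    using assms by (auto simp: bounded_degrees_def b_matching_def)
  have "mdeg M (Inr i) \<le> mdeg M (Inl i)"
    using M(1) by (induction M) (auto simp: mdeg_add_mset whisker_def)
  then show ?thesis
    using M(2,3) by (meson le_funD order_trans)
qed

text \<open>For degrees the inequality holds edge by edge: the whisker at \<open>i\<close> is
  counted on the right at its leaf, a whisker at a neighbour at that neighbour, and a graph edge at
  \<open>i\<close> at its other end.\<close>

lemma star_degree_le:
  fixes E :: "'n::finite set set"
  assumes "f \<in> bounded_degrees (whisker E) c" and N: "N = {j. {i, j} \<in> E}" and two: "\<forall>e\<in>E. card e = 2"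
  shows "f (Inl i) + (\<Sum>j\<in>N. f (Inr j)) \<le> c (Inr i) + (\<Sum>j\<in>N. c (Inl j))"
proof -
  obtain M where M: "set_mset M \<subseteq> whisker E" "mdeg M \<le> c" "f \<le> mdeg M"
    using assms(1) by (auto simp: bounded_degrees_def b_matching_def)
  have "mdeg M (Inl i) + (\<Sum>j\<in>N. mdeg M (Inr j)) \<le> mdeg M (Inr i) + (\<Sum>j\<in>N. mdeg M (Inl j))"
    using M(1)
  proof (induction M)
    case (add e M)
    let ?ind = "\<lambda>v. if v \<in> e then 1 else 0 :: nat"
    have "?ind (Inl i) + (\<Sum>j\<in>N. ?ind (Inr j)) \<le> ?ind (Inr i) + (\<Sum>j\<in>N. ?ind (Inl j))"
    proof -
      consider l where "e = {Inl l, Inr l}" | e' where "e' \<in> E" "e = Inl ` e'"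
        using add.prems by (auto simp: whisker_def)
      then show ?thesis
      proof cases
        case 1
        then show ?thesis
          by simp
      next
        case 2
        have "1 \<le> (\<Sum>j\<in>N. ?ind (Inl j))" if i: "i \<in> e'"
        proof -
          obtain j where j: "e' = {i, j}"
            using i two 2(1) by (metis card_2_iff doubleton_eq_iff insertE singletonD)
          then have "j \<in> N"
            using 2 N by simp
          then have "?ind (Inl j) \<le> (\<Sum>j\<in>N. ?ind (Inl j))"
            by (intro member_le_sum) auto
          then show ?thesis
            using 2 j by simp
        qed
        moreover have "(\<Sum>j\<in>N. ?ind (Inr j)) = 0"
          using 2 by auto
        ultimately show ?thesis
          using 2 by (cases "i \<in> e'") auto
      qed
    qed
    then show ?case
      using add by (simp add: mdeg_add_mset sum.distrib)
  qed simp
  moreover have "(\<Sum>j\<in>N. f (Inr j)) \<le> (\<Sum>j\<in>N. mdeg M (Inr j))"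
    "(\<Sum>j\<in>N. mdeg M (Inl j)) \<le> (\<Sum>j\<in>N. c (Inl j))"
    using M(2,3) by (auto intro!: sum_mono simp: le_fun_def)
  moreover have "f (Inl i) \<le> mdeg M (Inl i)" "mdeg M (Inr i) \<le> c (Inr i)"
    using M(2,3) by (auto simp: le_fun_def)
  ultimately show ?thesis
    by linarith
qed

text \<open>A leaf has no larger degree than its vertex, so every coordinate is at most
  \<open>m\<close>; the vertices of the cube lie below the vector obtained by taking each whisker
  \<open>m\<close> times.\<close>

lemma convex_hull_whisker_cube:
  fixes E :: "'n::finite set set"
  assumes c: "\<And>i. c (Inl i) = m" "\<And>i. m \<le> c (Inr i)"
  shows "convex hull (real_vec ` bounded_degrees (whisker E) c)
    = (*\<^sub>R) (real m) ` (unit_cube :: (real ^ ('n + 'n)) set)" (is "?L = ?R")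
proof
  have "convex (unit_cube :: (real ^ ('n + 'n)) set)"
    by (simp add: unit_cube_eq_cbox convex_box)
  then have "convex ?R"
    by (rule convex_scaling)
  moreover have "real_vec f \<in> ?R" if f: "f \<in> bounded_degrees (whisker E) c" for f
  proof (cases "m = 0")
    case True
    have "f v \<le> m" for v
      using leaf_degree_le[OF f] bounded_degrees_le[OF f] c by (cases v) metis+
    then have "real_vec f = real m *\<^sub>R 0"
      by (simp add: True vec_eq_iff)
    moreover have "0 \<in> (unit_cube :: (real ^ ('n + 'n)) set)"
      by (simp add: unit_cube_def)
    ultimately show ?thesis
      by blast
  next
    case False
    have "f v \<le> m" for v
      using leaf_degree_le[OF f] bounded_degrees_le[OF f] c by (cases v) metis+
    then have "(1 / real m) *\<^sub>R real_vec f \<in> unit_cube"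
      using False by (simp add: unit_cube_def divide_simps)
    moreover have "real_vec f = real m *\<^sub>R ((1 / real m) *\<^sub>R real_vec f)"
      using False by simp
    ultimately show ?thesis
      by blast
  qed
  ultimately show "?L \<subseteq> ?R"
    by (intro hull_minimal) auto
  show "?R \<subseteq> ?L"
    unfolding unit_cube_convex_hull_vec convex_hull_scaling[symmetric]
  proof (rule hull_mono, clarify)
    fix x :: "real ^ ('n + 'n)"
    assume x: "\<forall>i. x $ i = 0 \<or> x $ i = 1"
    define f where "f v = (if x $ v = 1 then m else 0)" for v
    have "f \<in> bounded_degrees (whisker E) c"
    proof (rule whisker_degrees[of "\<lambda>_. m"])
      have "m \<le> c v" for v
        using c by (cases v) auto
      then show "case_sum (\<lambda>_. m) (\<lambda>_. m) \<le> c"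
        by (simp add: le_fun_def split: sum.split)
      show "f \<le> case_sum (\<lambda>_. m) (\<lambda>_. m)"
        by (simp add: le_fun_def f_def split: sum.split)
    qed
    moreover have "real m *\<^sub>R x = real_vec f"
      using x by (auto simp: vec_eq_iff f_def)
    ultimately show "real m *\<^sub>R x \<in> real_vec ` bounded_degrees (whisker E) c"
      by simp
  qed
qed

section \<open>Capacities forced by reflexivity\<close>

lemma reflexive_whisker_caps:
  fixes E :: "'n::finite set set" and c :: "'n + 'n \<Rightarrow> nat"
  assumes G: "graph E" and pos: "\<And>v. c v > 0" and "d > 0" and a: "a \<in> lattice_points"
    and reflexive: "reflexive_polytope ((\<lambda>x. real d *\<^sub>R x - a) `
        (convex hull (real_vec ` bounded_degrees (whisker E) c)))"
  shows "d * c (Inl i) = 2 \<and> c (Inl i) \<le> c (Inr i)"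
proof -
  let ?D = "bounded_degrees (whisker E) c"
  have pos1: "1 \<le> c v" for v
    using pos[of v] by simp
  have a1: "a $ v = 1" for v
  proof (rule coordinate_facet[OF reflexive \<open>d > 0\<close> a])
    fix f :: "'n + 'n \<Rightarrow> nat"
    assume "f \<le> (\<lambda>_. 1)"
    then show "f \<in> ?D"
      using pos1 by (intro whisker_degrees[of "\<lambda>_. 1"]) (auto simp: le_fun_def split: sum.split)
  qed
  \<comment> \<open>The translation vector is all-one, so its sum over \<open>A\<close> in
    \<open>rank_facet\<close> is the cardinality of \<open>A\<close>.\<close>
  have facet: "d * B = card A + 1"
    if "\<And>f. f \<in> ?D \<Longrightarrow> sum f A \<le> B" "u \<in> A" "B > 0"
      "(\<lambda>w. if w = u then B else 0) \<in> ?D"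
      "\<And>v. v \<notin> A \<Longrightarrow> (\<lambda>w. if w = u then B else if w = v then 1 else 0) \<in> ?D"
      "\<And>v. v \<in> A \<Longrightarrow> v \<noteq> u \<Longrightarrow> (\<lambda>w. if w = u then B - 1 else if w = v then 1 else 0) \<in> ?D"
    for A B u
  proof -
    have "real d * real B = real (card A + 1)"
      using rank_facet[OF reflexive \<open>d > 0\<close> a, of A B u] that by (simp add: a1)
    then show ?thesis
      by (simp only: of_nat_eq_iff flip: of_nat_mult)
  qed
  have leaf: "d * min (c (Inl l)) (c (Inr l)) = 2" for l
  proof -
    let ?m = "min (c (Inl l)) (c (Inr l))"
    \<comment> \<open>The whisker at \<open>l\<close> is used as often as its ends allow, which
      saturates the bound at the leaf; one copy of every other whisker supplies the extra
      units.\<close>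
    let ?t = "\<lambda>j. if j = l then ?m else 1"
    have mem: "f \<in> ?D" if "f \<le> case_sum ?t ?t" for f
      using that pos1 by (intro whisker_degrees[of ?t]) (auto simp: le_fun_def split: sum.split)
    have "d * ?m = card {Inr l :: 'n + 'n} + 1"
    proof (rule facet)
      show "sum f {Inr l} \<le> ?m" if "f \<in> ?D" for f
        using leaf_degree_le[OF that] bounded_degrees_le[OF that] by simp
    qed (use pos in \<open>auto intro!: mem simp: le_fun_def Suc_le_eq split: sum.split\<close>)
    then show ?thesis
      by simp
  qed
  have ge2: "2 \<le> d * c (Inl l)" for l
    using leaf[of l] by (metis min.cobounded1 mult_le_mono2)
  have "c (Inl i) \<le> c (Inr i)"
  proof (rule ccontr)
    assume "\<not> ?thesis"
    then have less: "c (Inr i) < c (Inl i)"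
      by simp
    define m where "m = c (Inr i)"
    have m: "d * m = 2" "0 < m" "m < c (Inl i)"
      using leaf[of i] less pos by (simp_all add: m_def)
    have two: "\<forall>e\<in>E. card e = 2"
      using G by (simp add: graph_def)
    define N where "N = {j. {i, j} \<in> E}"
    have iN: "i \<notin> N"
      using two by (auto simp: N_def)
    have "N \<noteq> {}"
    proof -
      obtain e where "e \<in> E" "i \<in> e"
        using G by (auto simp: graph_def)
      then obtain j where "e = {i, j}"
        using two by (metis card_2_iff doubleton_eq_iff insertE singletonD)
      then show ?thesis
        using \<open>e \<in> E\<close> by (auto simp: N_def)
    qed
    \<comment> \<open>By \<open>star_degree_le\<close> this bounds the degree of
      \<open>Inl i\<close> apart from its own capacity: its whisker gives at most \<open>m\<close>,
      its neighbours at most their capacities.\<close>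
    define B where "B = m + (\<Sum>j\<in>N. c (Inl j))"
    show False
    proof (cases "c (Inl i) < B")
      case True
      \<comment> \<open>The vertex \<open>Inl i\<close> can be saturated so as to leave a free unit at any other vertex, so
        its capacity bounds a facet.\<close>
      have slack: "f \<in> ?D"
        if f: "f \<le> (\<lambda>w. if w = Inl i then c (Inl i) else if w = Inr i then 1 else
            if w = Inl l \<or> w = Inr l then 1 else 0)" for f l
      proof -
        \<comment> \<open>One unit at \<open>l\<close> is reserved. As \<open>c (Inl i) < B\<close>,
          the neighbours still supply the \<open>c (Inl i) - m\<close> units needed beyond the
          whisker at \<open>i\<close>.\<close>
        define g where "g j = (if j \<in> N then c (Inl j) - (if j = l then 1 else 0) else 0)" for j
        have "(\<Sum>j\<in>N. c (Inl j)) \<le> (\<Sum>j\<in>N. g j + (if j = l then 1 else 0))"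
          by (intro sum_mono) (auto simp: g_def)
        also have "\<dots> \<le> sum g UNIV + 1"
        proof -
          have "sum g N \<le> sum g UNIV"
            by (rule sum_mono2) auto
          then show ?thesis
            by (auto simp: sum.distrib)
        qed
        finally have "c (Inl i) - m \<le> sum g UNIV"
          using True by (simp add: B_def)
        then obtain k where k: "k \<le> g" "sum k UNIV = c (Inl i) - m"
          using ex_le_sum_eq by blast
        \<comment> \<open>The whisker at \<open>i\<close> is used \<open>m\<close> times; one
          whisker at another \<open>l\<close> takes the reserved unit and serves the leaf of
          \<open>l\<close>.\<close>
        define t where "t j = (if j = i then m else if j = l then 1 else 0)" for j
        have kg: "k j \<le> g j" for j
          using k(1) by (simp add: le_fun_def)
        have kN: "k j = 0" if "j \<notin> N" for j
          using kg[of j] that by (simp add: g_def)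
        have kc: "t j + k j \<le> c (Inl j)" if "j \<noteq> i" for j
          using kg[of j] that pos1[of "Inl j"] by (auto simp: g_def t_def split: if_splits)
        show ?thesis
        proof (rule star_degrees[OF _ _ refl])
          show "{i, j} \<in> E" if "k j \<noteq> 0" for j
            using kN[of j] that unfolding N_def by blast
          show "k i = 0"
            using kN iN by simp
          show "case_sum (\<lambda>l. t l + (if l = i then sum k UNIV else k l)) t \<le> c"
            using kc m k(2) pos1 by (auto simp: le_fun_def t_def m_def split: sum.split)
          show "f \<le> case_sum (\<lambda>l. t l + (if l = i then sum k UNIV else k l)) t"
          proof (rule order_trans[OF f])
            show "(\<lambda>w. if w = Inl i then c (Inl i) else if w = Inr i then 1 else
              if w = Inl l \<or> w = Inr l then 1 else 0) \<le> case_sum (\<lambda>l. t l + (if l = i then sum k UNIV else k l)) t"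
              using m k(2) by (auto simp: le_fun_def t_def split: sum.split)
          qed
        qed
      qed
      have "d * c (Inl i) = card {Inl i :: 'n + 'n} + 1"
      proof (rule facet)
        show "sum f {Inl i} \<le> c (Inl i)" if "f \<in> ?D" for f
          using bounded_degrees_le[OF that] by simp
        show "(\<lambda>w. if w = Inl i then c (Inl i) else 0) \<in> ?D"
          by (rule slack[of _ i]) (simp add: le_fun_def)
        show "(\<lambda>w. if w = Inl i then c (Inl i) else if w = v then 1 else 0) \<in> ?D" if "v \<notin> {Inl i}" for v
          by (cases v; hypsubst, rule slack) (auto simp: le_fun_def)
      qed (use pos in auto)
      \<comment> \<open>Since \<open>d * m\<close> is two as well, \<open>c (Inl i)\<close> would
        equal \<open>m\<close>.\<close>
      then show False
        using m \<open>d > 0\<close> by (metis card_1_singleton_iff is_singletonI is_singleton_altdef mult_cancel1 one_add_one nat_neq_iff)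
    next
      case False
      \<comment> \<open>Giving \<open>Inl i\<close> its maximal degree \<open>B\<close> uses up all its neighbours and so blocks their
        leaves: the facet is the one of \<open>Inl i\<close> together with the leaves at its neighbours.\<close>
      let ?A = "insert (Inl i) (Inr ` N)"
      have full: "f \<in> ?D"
        if f: "f \<le> case_sum (\<lambda>j. if j = i then B else 1) (\<lambda>j. if j \<in> N then 0 else 1)" for f
      proof -
        define k where "k j = (if j \<in> N then c (Inl j) else 0)" for j
        define t where "t j = (if j = i then m else if j \<in> N then 0 else 1)" for j
        have sk: "sum k UNIV = (\<Sum>j\<in>N. c (Inl j))"
          by (simp add: k_def sum.If_cases)
        show ?thesis
        proof (rule star_degrees[OF _ _ refl])
          show "{i, j} \<in> E" if "k j \<noteq> 0" for j
            using that by (auto simp: N_def k_def split: if_splits)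
          show "k i = 0"
            using iN by (simp add: k_def)
          show "case_sum (\<lambda>l. t l + (if l = i then sum k UNIV else k l)) t \<le> c"
          proof -
            have "t j + k j \<le> c (Inl j)" if "j \<noteq> i" for j
              using that pos1[of "Inl j"] by (simp add: t_def k_def)
            moreover have "t i + sum k UNIV \<le> c (Inl i)"
              using False sk by (simp add: t_def B_def)
            moreover have "t j \<le> c (Inr j)" for j
              using pos1[of "Inr j"] by (simp add: t_def m_def)
            ultimately show ?thesis
              by (auto simp: le_fun_def split: sum.split)
          qed
          show "f \<le> case_sum (\<lambda>l. t l + (if l = i then sum k UNIV else k l)) t"
          proof (rule order_trans[OF f])
            have "t i = m" "(if j \<in> N then 0 else 1) \<le> t j" for j
              using m(2) by (simp_all add: t_def)
            moreover have "1 \<le> t j + k j" for j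
              using m pos1[of "Inl j"] by (simp add: t_def k_def)
            ultimately show "case_sum (\<lambda>j. if j = i then B else 1) (\<lambda>j. if j \<in> N then 0 else 1)
              \<le> case_sum (\<lambda>l. t l + (if l = i then sum k UNIV else k l)) t"
              using m(2) sk
              by (simp add: le_fun_def B_def split: sum.split)
          qed
        qed
      qed
      \<comment> \<open>One unit at \<open>Inl l\<close> moves from the edge towards
        \<open>i\<close> to its whisker, which lowers \<open>Inl i\<close> by one and raises the
        leaf to one.\<close>
      have swap: "(\<lambda>w. if w = Inl i then B - 1 else if w = Inr l then 1 else 0) \<in> ?D" if l: "l \<in> N" for l
      proof -
        define k where "k j = (if j \<in> N then c (Inl j) - (if j = l then 1 else 0) else 0)" for j
        define t where "t j = (if j = i then m else if j = l then 1 else 0)" for j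
        have "sum k UNIV = sum k N"
          by (rule sum.mono_neutral_right) (auto simp: k_def)
        moreover have "(\<Sum>j\<in>N. c (Inl j)) = (\<Sum>j\<in>N. k j + (if j = l then 1 else 0))"
          using pos1 by (intro sum.cong) (auto simp: k_def)
        ultimately have sk: "sum k UNIV + 1 = (\<Sum>j\<in>N. c (Inl j))"
          using l by (simp add: sum.distrib)
        show ?thesis
        proof (rule star_degrees[OF _ _ refl])
          show "{i, j} \<in> E" if "k j \<noteq> 0" for j
            using that by (auto simp: N_def k_def split: if_splits)
          show "k i = 0"
            using iN by (simp add: k_def)
          have "t j + k j \<le> c (Inl j)" if "j \<noteq> i" for j
            using that l pos1[of "Inl j"] by (auto simp: t_def k_def)
          moreover have "t i + sum k UNIV \<le> c (Inl i)"
            using False sk by (simp add: t_def B_def)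
          moreover have "t j \<le> c (Inr j)" for j
            using pos1[of "Inr j"] by (auto simp: t_def m_def)
          ultimately show "case_sum (\<lambda>l. t l + (if l = i then sum k UNIV else k l)) t \<le> c"
            by (auto simp: le_fun_def split: sum.split)
          show "(\<lambda>w. if w = Inl i then B - 1 else if w = Inr l then 1 else 0)
            \<le> case_sum (\<lambda>l. t l + (if l = i then sum k UNIV else k l)) t"
            using sk l iN by (auto simp: le_fun_def t_def B_def split: sum.split)
        qed
      qed
      have "d * B = card ?A + 1"
      proof (rule facet)
        show "sum f ?A \<le> B" if "f \<in> ?D" for f
        proof -
          have "sum f ?A = f (Inl i) + (\<Sum>j\<in>N. f (Inr j))"
            by (subst sum.insert) (auto simp: sum.reindex)
          then show ?thesis
            using star_degree_le[OF that N_def two] by (simp add: B_def m_def)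
        qed
        show "(\<lambda>w. if w = Inl i then B else 0) \<in> ?D"
          by (rule full) (auto simp: le_fun_def split: sum.split)
        show "(\<lambda>w. if w = Inl i then B else if w = v then 1 else 0) \<in> ?D" if "v \<notin> ?A" for v
          using that by (intro full) (auto simp: le_fun_def split: sum.split)
        show "(\<lambda>w. if w = Inl i then B - 1 else if w = v then 1 else 0) \<in> ?D"
          if "v \<in> ?A" "v \<noteq> Inl i" for v
          using that swap by auto
      qed (use m in \<open>auto simp: B_def\<close>)
      moreover have "card ?A = card N + 1"
        by (simp add: card_insert_if card_image image_iff)
      \<comment> \<open>By \<open>ge2\<close> each neighbour adds at least two to
        \<open>d * B\<close>, and \<open>d * m\<close> is two; the facet equation allows two plus
        only one for each neighbour.\<close>
      moreover have "d * B \<ge> 2 + 2 * card N"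
      proof -
        have "2 * card N \<le> (\<Sum>j\<in>N. d * c (Inl j))"
          using sum_mono[of N "\<lambda>_. 2" "\<lambda>j. d * c (Inl j)"] ge2 by simp
        then show ?thesis
          using m by (simp add: B_def algebra_simps sum_distrib_left)
      qed
      moreover have "card N > 0"
        using \<open>N \<noteq> {}\<close> by (simp add: card_gt_0_iff)
      ultimately show False
        by simp
    qed
  qed
  then show ?thesis
    using leaf[of i] by simp
qed

section \<open>Classification of the Gorenstein polytopes of whiskered graphs\<close>

theorem theorem8p2:
  fixes E :: "'n::finite set set"
  assumes "graph E"
  shows "{P :: (real ^ ('n + 'n)) set. gorenstein_polytope P \<and>
            (\<exists>c :: 'n + 'n \<Rightarrow> nat. (\<forall>v. c v > 0) \<and>
               P = convex hull (divisor_vectors TYPE('k::field) (whisker E) c))}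
         = {unit_cube, (\<lambda>x. x + 1) ` centered_cube}"
proof -
  have hull: "convex hull (divisor_vectors TYPE('k) (whisker E) c)
      = convex hull (real_vec ` bounded_degrees (whisker E) c)"
    if pos: "\<forall>v. c v > 0" for c :: "'n + 'n \<Rightarrow> nat"
  proof -
    \<comment> \<open>A single whisker respects positive capacities and is the nonempty b-matching
      that \<open>divisor_vectors_eq\<close> asks for.\<close>
    have "b_matching (whisker E) c {#{Inl i, Inr i}#}" for i
      using pos by (auto simp: b_matching_def whisker_def le_fun_def mdeg_add_mset Suc_le_eq)
    then have "\<exists>M. b_matching (whisker E) c M \<and> 1 \<le> size M"
      by (metis order_refl size_single)
    then have "divisor_vectors TYPE('k) (whisker E) c = real_vec ` bounded_degrees (whisker E) c"
      using divisor_vectors_eq[OF card_whisker[OF assms], of c]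
      by (auto simp: bounded_degrees_def real_vec_def)
    then show ?thesis
      by simp
  qed
  have cube1: "unit_cube = (*\<^sub>R) (real 1) ` (unit_cube :: (real ^ ('n + 'n)) set)"
    by simp
  have cube2: "(\<lambda>x. x + 1) ` centered_cube = (*\<^sub>R) (real 2) ` (unit_cube :: (real ^ ('n + 'n)) set)"
    by (simp add: centered_cube_def image_image)
  have "(gorenstein_polytope P \<and> (\<exists>c :: 'n + 'n \<Rightarrow> nat. (\<forall>v. c v > 0) \<and>
      P = convex hull (divisor_vectors TYPE('k) (whisker E) c)))
    \<longleftrightarrow> (\<exists>m. (m = 1 \<or> m = 2) \<and> P = (*\<^sub>R) (real m) ` unit_cube)" (is "?L \<longleftrightarrow> ?R")
    for P :: "(real ^ ('n + 'n)) set"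
  proof
    assume ?L
    then obtain c d a where c: "\<forall>v. c v > 0" and P: "P = convex hull (real_vec ` bounded_degrees (whisker E) c)"
      and d: "d > 0" and a: "a \<in> lattice_points"
      and reflexive: "reflexive_polytope ((\<lambda>x. real d *\<^sub>R x - a) ` P)"
      unfolding gorenstein_polytope_def using hull by auto
    have caps: "d * c (Inl i) = 2 \<and> c (Inl i) \<le> c (Inr i)" for i
      by (rule reflexive_whisker_caps[OF assms _ d a]) (use c reflexive P in auto)
    \<comment> \<open>Here \<open>undefined\<close> is an arbitrary base vertex. The same
      \<open>d\<close> occurs in all the equations, so the capacity is the same at every
      \<open>Inl i\<close>.\<close>
    define m where "m = c (Inl undefined)"
    have m: "c (Inl i) = m" for i
      using caps[of i] caps[of undefined] d by (metis m_def mult_cancel1 neq0_conv)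
    then have "m dvd 2"
      using caps by (metis dvd_triv_right)
    then have "m = 1 \<or> m = 2"
      using two_is_prime_nat prime_nat_iff by blast
    moreover have "P = (*\<^sub>R) (real m) ` unit_cube"
      unfolding P by (rule convex_hull_whisker_cube) (use m caps in auto)
    ultimately show ?R
      by blast
  next
    assume ?R
    then obtain m :: nat where m: "m = 1 \<or> m = 2" and P: "P = (*\<^sub>R) (real m) ` unit_cube"
      by blast
    have "P = convex hull (divisor_vectors TYPE('k) (whisker E) (\<lambda>_. m))"
      using m by (subst hull) (auto simp: P convex_hull_whisker_cube)
    then show ?L
      using m gorenstein_scaled_cube[OF m] P by (intro conjI exI[of _ "\<lambda>_. m"]) auto
  qed
  then have "{P :: (real ^ ('n + 'n)) set. gorenstein_polytope P \<and> (\<exists>c :: 'n + 'n \<Rightarrow> nat. (\<forall>v. c v > 0) \<and>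
      P = convex hull (divisor_vectors TYPE('k) (whisker E) c))}
    = {P. \<exists>m. (m = 1 \<or> m = 2) \<and> P = (*\<^sub>R) (real m) ` unit_cube}"
    by (rule Collect_cong)
  also have "\<dots> = {(*\<^sub>R) (real 1) ` unit_cube, (*\<^sub>R) (real 2) ` unit_cube}"
    by blast
  finally show ?thesis
    unfolding cube2 cube1[symmetric] .
qed

end
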